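(* Let $p>3$ be a prime and, for $n\in\mathbb{N}$, let $f_n=\sum_{k=0}^n\binom{n}{k}^3$ be the Franel numbers. Then $$\sum_{k=0}^{p-1}(-1)^k f_k\equiv \left(\frac{p}{3}\right)+\frac{2p^2}{3}B_{p-2}\left(\frac13\right)\pmod{p^3}.$$
   Context: $\left(\frac{\cdot}{3}\right)$ denotes the Legendre symbol. $B_n(x)=\sum_{k=0}^n\binom nk B_k x^{n-k}$ is the $n$th Bernoulli polynomial, where $B_k$ are the Bernoulli numbers. Congruences between rational numbers are understood in the ring of rationals whose denominators are coprime to $p$: $a\equiv b\pmod{p^m}$ means $(a-b)/p^m$ is such a rational. *)

theory Defs
  imports "HOL-Number_Theory.Number_Theory"
begin

text \<open>Bernoulli numbers via the standard recursion
  B_0 = 1 and sum_{k=0}^{n} binom(n+1,k) B_k = 0 for n >= 1 (so B_1 = -1/2).\<close>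
fun bernoulli :: "nat \<Rightarrow> rat" where
  "bernoulli n =
     (if n = 0 then 1
      else - (\<Sum>k\<in>{..<n}. of_nat ((n + 1) choose k) * (if k < n then bernoulli k else 0))
           / of_nat (n + 1))"

definition bernoulli_poly :: "nat \<Rightarrow> rat \<Rightarrow> rat" where
  "bernoulli_poly n x = (\<Sum>k\<le>n. of_nat (n choose k) * bernoulli k * x ^ (n - k))"

text \<open>Congruence of rationals modulo m in the ring of rationals whose
  denominators are coprime to p: a \<equiv> b (mod m) iff (a - b)/m = u/v with
  integers u, v, v coprime to p.\<close>
definition rat_cong :: "rat \<Rightarrow> rat \<Rightarrow> int \<Rightarrow> int \<Rightarrow> bool" where
  "rat_cong a b m p \<longleftrightarrow>
     (\<exists>u v :: int. v \<noteq> 0 \<and> coprime v p \<and> (a - b) / of_int m = of_int u / of_int v)"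

definition franel :: "nat \<Rightarrow> nat" where
  "franel n = (\<Sum>k\<le>n. (n choose k) ^ 3)"

end

theory Submission
  imports Defs "HOL-Computational_Algebra.Computational_Algebra"
begin

text \<open>
  Write \<open>f\<^sub>n = \<Sum>\<^sub>j C(2j,j) C(n,j) C(j,n-j)\<close>. For fixed \<open>j\<close> the sum of \<open>(-1)\<^sup>n C(n,j) C(j,n-j)\<close> over
  all \<open>n\<close> is 1, so the alternating sum of the \<open>f\<^sub>n\<close> with \<open>n < p\<close> is the sum of the \<open>C(2j,j)\<close> with
  \<open>j < p\<close>, minus a tail with \<open>n \<ge> p\<close> in which every term is divisible by \<open>p\<^sup>2\<close>.

  Let \<open>h\<close> be the sequence 0, 1, 1, 0, -1, -1 of period 6 and \<open>S = \<Sum>\<^sub>0\<^sub><\<^sub>k\<^sub><\<^sub>p h(k)/k\<^sup>2\<close>. The sum of the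
  \<open>C(2j,j)\<close> is a combination of the \<open>C(2p,k)\<close> with coefficients \<open>\<plusminus>h\<close>; comparing with \<open>2 C(p,k)\<close>
  leaves \<open>(p/3) - 4 p\<^sup>2 S\<close> modulo \<open>p\<^sup>3\<close>. The tail divided by \<open>p\<^sup>2\<close> is, modulo \<open>p\<close>,
  \<open>-3/2 \<Sum>\<^sub>m (m!)\<^sup>2/(2m+1)! \<Sum>\<^sub>k\<^sub>\<le>\<^sub>m C(2k,k)/k\<close>. Since \<open>(m!)\<^sup>2/(2m+1)!\<close> is the integral of
  \<open>(t - t\<^sup>2)\<^sup>m\<close> over \<open>[0,1]\<close> and \<open>\<Sum>\<^sub>k C(2k,k) (t - t\<^sup>2)\<^sup>k/k\<close> is \<open>2 \<Sum>\<^sub>r t\<^sup>r/r\<close> modulo \<open>p\<close>, this is a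
  finite dilogarithm at a sixth root of unity and equals \<open>-12 S\<close>. Finally, Bernoulli polynomials
  sum the powers \<open>x\<^sup>p\<^sup>-\<^sup>3\<close>, which represent \<open>1/x\<^sup>2\<close>, and this gives \<open>B\<^sub>p\<^sub>-\<^sub>2(1/3) = 12 S\<close> modulo \<open>p\<close>.
\<close>

(* As a rewrite rule, the recursion equation of bernoulli unfolds forever. *)
declare bernoulli.simps [simp del]

subsection \<open>Binomial sums\<close>

text \<open>Trinomial revision turns the summand into C(n,j)^2 C(2j,n). Vandermonde splits C(2j,n),
  a second revision extracts C(n,i)^2, and summing over j first lets Vandermonde supply the third
  factor C(n,i).\<close>

lemma franel_eq_sum_choose:
  "franel n = (\<Sum>j\<le>n. (2 * j choose j) * (n choose j) * (j choose (n - j)))"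
proof -
  \<comment> \<open>The guards offset truncated subtraction: without them
    \<open>(n - i) choose (j - i)\<close> would be 1 instead of 0 when j < i.\<close>
  have summand: "(2 * j choose j) * (n choose j) * (j choose (n - j)) =
      (\<Sum>i\<le>n. (n choose i)\<^sup>2 * ((if i \<le> j then (n - i) choose (j - i) else 0)
         * (if n - i \<le> j then i choose (j - (n - i)) else 0)))"
    if "j \<le> n" for j
  proof -
    have "(2 * j choose j) * (j choose (n - j)) = (n choose j) * (2 * j choose n)"
    proof (cases "n \<le> 2 * j")
      case True
      have "(2 * j choose n) * (n choose j) = (2 * j choose j) * ((2 * j - j) choose (n - j))"
        using choose_mult[of j n "2 * j"] that True by simp
      then show ?thesis by (simp add: mult.commute)
    qed (simp add: binomial_eq_0)
    then have "(2 * j choose j) * (n choose j) * (j choose (n - j))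
        = (n choose j)\<^sup>2 * (2 * j choose n)"
      by (simp add: power2_eq_square algebra_simps)
    also have "(2 * j choose n) = (\<Sum>i\<le>n. (j choose i) * (j choose (n - i)))"
      using vandermonde[of j j n] by (simp add: mult_2)
    also have "(n choose j)\<^sup>2 * \<dots> = (\<Sum>i\<le>n. ((n choose j) * (j choose i)) * ((n choose j) * (j choose (n - i))))"
      by (simp add: sum_distrib_left power2_eq_square algebra_simps)
    also have "\<dots> = (\<Sum>i\<le>n. (n choose i)\<^sup>2 * ((if i \<le> j then (n - i) choose (j - i) else 0)
         * (if n - i \<le> j then i choose (j - (n - i)) else 0)))"
    proof (intro sum.cong refl)
      fix i assume "i \<in> {..n}"
      then have i: "i \<le> n" by simp
      have 1: "(n choose j) * (j choose i) = (n choose i) * (if i \<le> j then (n - i) choose (j - i) else 0)"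
        using choose_mult[of i j n] that by (auto simp: binomial_eq_0)
      have 2: "(n choose j) * (j choose (n - i)) = (n choose i) * (if n - i \<le> j then i choose (j - (n - i)) else 0)"
        using choose_mult[of "n - i" j n] that i binomial_symmetric[OF i] by (auto simp: binomial_eq_0)
      show "((n choose j) * (j choose i)) * ((n choose j) * (j choose (n - i))) =
        (n choose i)\<^sup>2 * ((if i \<le> j then (n - i) choose (j - i) else 0)
         * (if n - i \<le> j then i choose (j - (n - i)) else 0))"
        unfolding 1 2 by (simp add: power2_eq_square)
    qed
    finally show ?thesis .
  qed
  have inner: "(\<Sum>j\<le>n. (if i \<le> j then (n - i) choose (j - i) else 0)
         * (if n - i \<le> j then i choose (j - (n - i)) else 0)) = n choose i" if i: "i \<le> n" for i
  proof -
    have "(\<Sum>j\<le>n. (if i \<le> j then (n - i) choose (j - i) else 0)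
         * (if n - i \<le> j then i choose (j - (n - i)) else 0))
       = (\<Sum>j\<in>{n - i..n}. ((n - i) choose (n - j)) * (i choose (j - (n - i))))"
    proof (rule sum.mono_neutral_cong_right)
      show "\<forall>j\<in>{..n} - {n - i..n}. (if i \<le> j then (n - i) choose (j - i) else 0)
         * (if n - i \<le> j then i choose (j - (n - i)) else 0) = 0" by auto
    next
      fix j assume "j \<in> {n - i..n}"
      then have j: "n - i \<le> j" "j \<le> n" by auto
      have "(if i \<le> j then (n - i) choose (j - i) else 0) = (n - i) choose (n - j)"
      proof (cases "i \<le> j")
        case True
        then show ?thesis using binomial_symmetric[of "j - i" "n - i"] j i by simp
      next
        case False
        then have "n - i < n - j" using i j by linarith
        then show ?thesis using False by (simp add: binomial_eq_0)
      qed
      then show "(if i \<le> j then (n - i) choose (j - i) else 0)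
         * (if n - i \<le> j then i choose (j - (n - i)) else 0) = ((n - i) choose (n - j)) * (i choose (j - (n - i)))"
        using j by simp
    qed auto
    also have "\<dots> = (\<Sum>k\<le>i. ((n - i) choose k) * (i choose (i - k)))"
      by (rule sum.reindex_bij_witness[where i = "\<lambda>k. n - k" and j = "\<lambda>j. n - j"])
         (use i in \<open>auto simp: algebra_simps\<close>)
    also have "\<dots> = (n - i + i) choose i" by (rule vandermonde)
    finally show ?thesis using i by simp
  qed
  have "(\<Sum>j\<le>n. (2 * j choose j) * (n choose j) * (j choose (n - j)))
     = (\<Sum>j\<le>n. \<Sum>i\<le>n. (n choose i)\<^sup>2 * ((if i \<le> j then (n - i) choose (j - i) else 0)
         * (if n - i \<le> j then i choose (j - (n - i)) else 0)))"
    by (intro sum.cong refl summand) simp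
  also have "\<dots> = (\<Sum>i\<le>n. (n choose i)\<^sup>2 * (\<Sum>j\<le>n. (if i \<le> j then (n - i) choose (j - i) else 0)
         * (if n - i \<le> j then i choose (j - (n - i)) else 0)))"
    by (subst sum.swap) (simp add: sum_distrib_left)
  also have "\<dots> = (\<Sum>i\<le>n. (n choose i) ^ 3)"
    using inner by (intro sum.cong refl) (simp add: power2_eq_square power3_eq_cube)
  finally show ?thesis by (simp add: franel_def)
qed

text \<open>Pascal's rule: an (r+1)-st finite difference of \<open>g\<close> is an r-th difference
  of its first differences. This drives the inductions for the alternating binomial sums
  below.\<close>

lemma alternating_choose_Suc_sum:
  fixes g :: "nat \<Rightarrow> 'a::comm_ring_1"
  shows "(\<Sum>k\<le>Suc r. (-1) ^ k * of_nat (Suc r choose k) * g k)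
       = (\<Sum>k\<le>r. (-1) ^ k * of_nat (r choose k) * (g k - g (Suc k)))"
proof -
  have "(\<Sum>k\<le>Suc r. (-1) ^ k * of_nat (Suc r choose k) * g k)
     = g 0 + (\<Sum>k\<le>r. (-1) ^ Suc k * of_nat (Suc r choose Suc k) * g (Suc k))"
    by (subst sum.atMost_Suc_shift) simp
  also have "(\<Sum>k\<le>r. (-1) ^ Suc k * of_nat (Suc r choose Suc k) * g (Suc k))
     = - (\<Sum>k\<le>r. (-1) ^ k * of_nat (r choose k) * g (Suc k))
       + (\<Sum>k\<le>r. (-1) ^ Suc k * of_nat (r choose Suc k) * g (Suc k))"
    by (simp add: sum.distrib[symmetric] sum_negf[symmetric] algebra_simps)
  also have "(\<Sum>k\<le>r. (-1) ^ Suc k * of_nat (r choose Suc k) * g (Suc k))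
     = (\<Sum>k\<le>Suc r. (-1) ^ k * of_nat (r choose k) * g k) - g 0"
    by (subst sum.atMost_Suc_shift) simp
  also have "(\<Sum>k\<le>Suc r. (-1) ^ k * of_nat (r choose k) * g k)
     = (\<Sum>k\<le>r. (-1) ^ k * of_nat (r choose k) * g k)" by (simp add: binomial_eq_0)
  finally show ?thesis by (simp add: right_diff_distrib sum_subtractf)
qed

text \<open>Each difference in the upper argument lowers the lower index by one and contributes a
  sign, so \<open>j\<close> of them lead from \<open>b + j\<close> down to \<open>b\<close>.\<close>

lemma alternating_sum_choose_mult_choose:
  "(\<Sum>i\<le>j. (-1) ^ i * of_nat (j choose i) * of_nat ((a + i) choose (b + j)))
     = ((-1) ^ j * of_nat (a choose b) :: 'a::comm_ring_1)"
proof (induction j arbitrary: b)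
  case (Suc j)
  have "(\<Sum>i\<le>Suc j. (-1) ^ i * of_nat (Suc j choose i) * of_nat ((a + i) choose (b + Suc j)))
    = (\<Sum>i\<le>j. (-1) ^ i * of_nat (j choose i) * (of_nat ((a + i) choose (b + Suc j))
          - of_nat ((a + Suc i) choose (b + Suc j)) :: 'a))"
    by (rule alternating_choose_Suc_sum)
  also have "\<dots> = - (\<Sum>i\<le>j. (-1) ^ i * of_nat (j choose i) * of_nat ((a + i) choose (b + j)))"
    by (simp add: sum_negf[symmetric] algebra_simps)
  finally show ?case using Suc by simp
qed simp

text \<open>The case \<open>a = j\<close>, \<open>b = 0\<close> of the preceding sum. With n = j + i
  it runs over all n, so C(2j,j) acquires weight exactly 1 once no bound is put on n.\<close>

lemma central_convolution_sum:
  "(\<Sum>i\<le>j. (-1) ^ (j + i) * of_nat ((j + i) choose j) * of_nat (j choose i)) = (1 :: 'a::comm_ring_1)"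
proof -
  have "(\<Sum>i\<le>j. (-1) ^ (j + i) * of_nat ((j + i) choose j) * of_nat (j choose i))
    = (-1) ^ j * (\<Sum>i\<le>j. (-1) ^ i * of_nat (j choose i) * of_nat ((j + i) choose (0 + j)) :: 'a)"
    by (simp add: sum_distrib_left power_add algebra_simps)
  also have "\<dots> = 1"
    by (subst alternating_sum_choose_mult_choose) (simp add: power_add[symmetric] mult_2[symmetric])
  finally show ?thesis .
qed

text \<open>Differences with step 2 still lower the degree, so r of them annihilate a polynomial of
  degree b < r. Generalised binomials admit the upper argument -1, which occurs below at k =
  0.\<close>

lemma alternating_sum_gchoose_step2:
  fixes a :: "'a::field_char_0"
  assumes "b < r"
  shows "(\<Sum>k\<le>r. (-1) ^ k * of_nat (r choose k) * ((a + 2 * of_nat k) gchoose b)) = 0"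
  using assms
proof (induction r arbitrary: a b)
  case (Suc r)
  show ?case
  proof (cases b)
    case 0
    then show ?thesis
      by (subst alternating_choose_Suc_sum) simp
  next
    case (Suc c)
    have diff: "(x gchoose Suc c) - ((x + 2) gchoose Suc c) = - (((x + 1) gchoose c) + (x gchoose c))" for x :: 'a
      using gbinomial_Suc_Suc[of x c] gbinomial_Suc_Suc[of "x + 1" c] by (simp add: add.assoc)
    have "(\<Sum>k\<le>Suc r. (-1) ^ k * of_nat (Suc r choose k) * ((a + 2 * of_nat k) gchoose b))
      = (\<Sum>k\<le>r. (-1) ^ k * of_nat (r choose k) *
          (((a + 2 * of_nat k) gchoose Suc c) - ((a + 2 * of_nat k + 2) gchoose Suc c)))"
      unfolding Suc by (subst alternating_choose_Suc_sum) (simp add: algebra_simps)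
    also have "\<dots> = - ((\<Sum>k\<le>r. (-1) ^ k * of_nat (r choose k) * (((a + 1) + 2 * of_nat k) gchoose c))
        + (\<Sum>k\<le>r. (-1) ^ k * of_nat (r choose k) * ((a + 2 * of_nat k) gchoose c)))"
      unfolding diff by (simp add: sum.distrib[symmetric] sum_negf[symmetric] algebra_simps)
    also have "\<dots> = 0" using Suc.IH[of c] Suc.prems Suc by simp
    finally show ?thesis .
  qed
qed simp

text \<open>Coefficient of \<open>t\<^sup>r\<close> in \<open>\<Sum>\<^sub>k C(2k,k) (t - t\<^sup>2)\<^sup>k/k = -2 ln(1 - t)\<close>.\<close>
lemma sum_choose_over_index:
  assumes "r \<ge> 1"
  shows "(\<Sum>k=1..r. (-1) ^ (r + k) * of_nat (2 * k choose k) * of_nat (k choose (r - k)) / of_nat k)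
       = (2 / of_nat r :: rat)"
proof -
  \<comment> \<open>The denominator k is absorbed by r C(2k,r) = 2k C(2k-1,r-1); the last factor
    left is a polynomial of degree r - 1 in k.\<close>
  have t: "(-1) ^ (r + k) * of_nat (2 * k choose k) * of_nat (k choose (r - k)) / of_nat k
     = (2 / of_nat r) * ((-1) ^ r * ((-1) ^ k * of_nat (r choose k) * ((- 1 + 2 * of_nat k) gchoose (r - 1))) :: rat)"
    if k: "k \<in> {1..r}" for k
  proof -
    have "(2 * k choose k) * (k choose (r - k)) = (r choose k) * (2 * k choose r)"
    proof (cases "r \<le> 2 * k")
      case True
      have "(2 * k choose r) * (r choose k) = (2 * k choose k) * ((2 * k - k) choose (r - k))"
        using choose_mult[of k r "2 * k"] k True by simp
      then show ?thesis by (simp add: mult.commute)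
    qed (use k in \<open>simp add: binomial_eq_0\<close>)
    then have 1: "(of_nat (2 * k choose k) * of_nat (k choose (r - k)) :: rat) = of_nat (r choose k) * of_nat (2 * k choose r)"
      by (metis of_nat_mult)
    have "r * (2 * k choose r) = 2 * k * ((2 * k - 1) choose (r - 1))"
      using times_binomial_minus1_eq[of r "2 * k"] assms by simp
    then have 2: "(of_nat r * of_nat (2 * k choose r) :: rat) = 2 * of_nat k * of_nat ((2 * k - 1) choose (r - 1))"
      by (metis of_nat_mult of_nat_numeral)
    have 3: "of_nat ((2 * k - 1) choose (r - 1)) = ((- 1 + 2 * of_nat k) gchoose (r - 1) :: rat)"
      using k by (simp add: binomial_gbinomial of_nat_diff)
    have "of_nat (2 * k choose r) = 2 * of_nat k * ((- 1 + 2 * of_nat k) gchoose (r - 1)) / (of_nat r :: rat)"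
      using 2 3 assms by (simp add: field_simps)
    moreover have "of_nat k \<noteq> (0::rat)" using k by simp
    ultimately show ?thesis using 1 by (simp add: power_add mult.assoc)
  qed
  \<comment> \<open>The r-th difference of that polynomial vanishes once k = 0 is included, so the
    required sum is minus its term at k = 0.\<close>
  have "(\<Sum>k\<le>r. (-1) ^ k * of_nat (r choose k) * ((- 1 + 2 * of_nat k) gchoose (r - 1))) = (0::rat)"
    by (rule alternating_sum_gchoose_step2) (use assms in simp)
  moreover have "{..r} = insert 0 {1..r}" by auto
  moreover have "((- 1) gchoose (r - 1)) = ((-1) ^ (r - 1) :: rat)"
    by (subst gbinomial_minus) (simp add: binomial_gbinomial[symmetric])
  ultimately have s: "(\<Sum>k=1..r. (-1) ^ k * of_nat (r choose k) * ((- 1 + 2 * of_nat k) gchoose (r - 1)))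
      = - ((-1) ^ (r - 1) :: rat)"
    by (simp add: eq_neg_iff_add_eq_0 add.commute)
  have "(\<Sum>k=1..r. (-1) ^ (r + k) * of_nat (2 * k choose k) * of_nat (k choose (r - k)) / of_nat k)
     = (2 / of_nat r) * ((-1) ^ r * (\<Sum>k=1..r. (-1) ^ k * of_nat (r choose k) * ((- 1 + 2 * of_nat k) gchoose (r - 1))) :: rat)"
    by (simp add: t sum_distrib_left)
  also have "\<dots> = 2 / of_nat r"
    unfolding s using assms by (cases r) (auto simp: power_add[symmetric] mult_2[symmetric])
  finally show ?thesis .
qed

text \<open>This is the integral of t^c (1 - t)^m over [0,1] expanded binomially; a recursion in m
  takes the place of the integral.\<close>

lemma alternating_choose_beta_sum:
  "(\<Sum>i\<le>m. (-1) ^ i * of_nat (m choose i) / of_nat (c + i + 1))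
     = (fact m * fact c / fact (m + c + 1) :: 'a::field_char_0)"
proof (induction m arbitrary: c)
  case 0
  then show ?case by (simp del: of_nat_Suc)
next
  case (Suc m)
  have "(\<Sum>i\<le>Suc m. (-1) ^ i * of_nat (Suc m choose i) / of_nat (c + i + 1))
     = (\<Sum>i\<le>Suc m. (-1) ^ i * of_nat (Suc m choose i) * (1 / of_nat (c + i + 1) :: 'a))"
    by simp
  also have "\<dots> = (\<Sum>i\<le>m. (-1) ^ i * of_nat (m choose i) * (1 / of_nat (c + i + 1) - 1 / of_nat (c + Suc i + 1)))"
    by (rule alternating_choose_Suc_sum)
  also have "\<dots> = (\<Sum>i\<le>m. (-1) ^ i * of_nat (m choose i) / of_nat (c + i + 1))
       - (\<Sum>i\<le>m. (-1) ^ i * of_nat (m choose i) / of_nat (Suc c + i + 1))"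
    by (simp add: sum_subtractf algebra_simps)
  also have "\<dots> = fact m * fact c / fact (m + c + 1) - fact m * fact (Suc c) / fact (m + Suc c + 1)"
    by (simp only: Suc)
  also have "\<dots> = fact m * fact c / fact (m + c + 1) * (1 - of_nat (c + 1) / of_nat (m + c + 2))"
    by (simp add: field_simps del: of_nat_Suc of_nat_add)
  also have "1 - of_nat (c + 1) / of_nat (m + c + 2) = (of_nat (m + 1) / of_nat (m + c + 2) :: 'a)"
  proof -
    have "(of_nat (m + c + 2) :: 'a) = of_nat (m + 1) + of_nat (c + 1)"
      by simp
    moreover have "(of_nat (m + c + 2) :: 'a) \<noteq> 0"
      by (simp only: of_nat_eq_0_iff)
    ultimately show ?thesis by (simp add: field_simps del: of_nat_Suc of_nat_add)
  qed
  also have "fact m * fact c / fact (m + c + 1) * (of_nat (m + 1) / of_nat (m + c + 2)) = (fact (Suc m) * fact c / fact (Suc m + c + 1) :: 'a)"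
    by (simp add: field_simps del: of_nat_Suc of_nat_add)
  finally show ?case .
qed

subsection \<open>A sequence of period 6\<close>

text \<open>
  For a primitive sixth root of unity \<open>\<zeta>\<close> this is \<open>(\<zeta>\<^sup>i - \<zeta>\<^sup>-\<^sup>i)/(\<zeta> - \<zeta>\<^sup>-\<^sup>1)\<close>, which for \<open>i > 0\<close> equals
  \<open>(-1)\<^sup>i\<^sup>-\<^sup>1\<close> times the Legendre symbol \<open>(i/3)\<close>. The identity \<open>1 - \<zeta> = \<zeta>\<^sup>-\<^sup>1\<close> makes it well behaved under
  binomial transforms.
\<close>
definition hexa :: "int \<Rightarrow> int" where
  "hexa i = (if i mod 3 = 0 then 0 else if i mod 6 < 3 then 1 else -1)"

lemma hexa_simps [simp]: "hexa 0 = 0" "hexa 1 = 1"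
  by (auto simp: hexa_def)

lemma hexa_add_mult6: "hexa (6 * q + r) = hexa r"
proof -
  have "(6 * q + r) mod 3 = r mod 3"
    using mod_mult_self2[of r 3 "2 * q"] by (simp add: add.commute)
  then show ?thesis by (simp add: hexa_def)
qed

lemma mod6_cases:
  obtains q where "i = 6 * q" | q where "i = 6 * q + 1" | q where "i = 6 * q + 2"
    | q where "i = 6 * q + 3" | q where "i = 6 * q + 4" | q where "i = 6 * q + (5::int)"
proof -
  have "i = 6 * (i div 6) + i mod 6" by simp
  moreover have "i mod 6 \<in> {0, 1, 2, 3, 4, 5}" by auto
  ultimately show thesis
    using that by (metis add.right_neutral emptyE insertE)
qed

lemma hexa_mult6 [simp]: "hexa (6 * q) = 0"
  using hexa_add_mult6[of q 0] by (simp add: hexa_def)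

text \<open>A primitive sixth root of unity z satisfies z^2 = z - 1.\<close>

lemma hexa_rec: "hexa (i + 1) = hexa i - hexa (i - 1)"
proof (cases i rule: mod6_cases)
  case (1 q)
  then show ?thesis using hexa_add_mult6[of q 1] hexa_add_mult6[of q "-1"] by (simp add: hexa_def[of "-1"])
qed (simp_all add: add.assoc diff_conv_add_uminus hexa_add_mult6 del: add_uminus_conv_diff,
     simp_all add: hexa_def)

lemma hexa_minus: "hexa (- i) = - hexa i"
proof -
  have "hexa (- (6 * q + r)) = hexa (- r)" for q r
    using hexa_add_mult6[of "- q" "- r"] by simp
  moreover have "hexa (- (6 * q)) = 0" for q
    using hexa_mult6[of "- q"] by simp
  ultimately show ?thesis
    by (cases i rule: mod6_cases) (simp_all add: hexa_add_mult6, simp_all add: hexa_def)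
qed

lemma hexa_minus_diff: "hexa (i - j) = - hexa (j - i)"
  using hexa_minus[of "j - i"] by simp

text \<open>The hypotheses mean that q is 1 or -1 modulo 6, so by periodicity the shifts by q and -q
  are the shifts by 1 and -1 in some order, and \<open>hexa_rec\<close> applies.\<close>

lemma hexa_add_diff:
  assumes "odd q" and "\<not> 3 dvd q"
  shows "hexa (i + q) + hexa (i - q) = hexa i"
proof -
  have one: "hexa (j + 1) + hexa (j - 1) = hexa j" for j
    using hexa_rec[of j] by simp
  have shift: "hexa (j + 6 * u) = hexa j" "hexa (j - 6 * u) = hexa j" for j u
    using hexa_add_mult6[of u j] hexa_add_mult6[of "- u" j] by (simp_all add: algebra_simps)
  show ?thesis
  proof (cases q rule: mod6_cases)
    case (2 u)
    then show ?thesis using shift[of "i + 1" u] shift[of "i - 1" u] one[of i] by (simp add: algebra_simps)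
  next
    case (6 u)
    then show ?thesis using shift[of "i - 1" "u + 1"] shift[of "i + 1" "u + 1"] one[of i] by (simp add: algebra_simps)
  qed (use assms in \<open>auto; presburger\<close>)+
qed

text \<open>Expand (1 - z)^j = z^(-j) for a primitive sixth root of unity z; \<open>e\<close> is a
  free phase.\<close>

lemma alternating_choose_hexa_sum:
  "(\<Sum>k\<le>j. (-1) ^ k * of_nat (j choose k) * of_int (hexa (e + int k)))
     = (of_int (hexa (e - int j)) :: 'a::comm_ring_1)"
proof (induction j arbitrary: e)
  case (Suc j)
  have "hexa (e + int k) - hexa (e + int (Suc k)) = hexa ((e - 1) + int k)" for k
    using hexa_rec[of "e + int k"] by (simp add: algebra_simps)
  then have "(of_int (hexa (e + int k)) - of_int (hexa (e + int (Suc k))) :: 'a) = of_int (hexa ((e - 1) + int k))" for k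
    by (metis of_int_diff)
  then show ?case
    unfolding alternating_choose_Suc_sum Suc[of "e - 1", symmetric]
    using Suc[of "e - 1"] by (simp add: algebra_simps)
qed simp

text \<open>The weights are the Legendre symbols (i/3), whose consecutive triples sum to 0. Applying
  Pascal twice and moving the shifts onto the weights reproduces the previous sum plus the new term
  C(2n,n).\<close>

lemma sum_central_choose:
  "(\<Sum>k<n. int (2 * k choose k))
     = (\<Sum>i\<le>n. int (2 * n choose (n - i)) * ((-1) ^ (i + 1) * hexa (int i)))"
proof (induction n)
  case (Suc n)
  define c where "c i = (-1) ^ (i + 1) * hexa (int i)" for i :: nat
  \<comment> \<open>The cutoff matters: for j > n truncated subtraction would turn the binomial into
    1.\<close>
  define t where "t j = (if j \<le> n then int (2 * n choose (n - j)) else 0)" for j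
  have c0: "c 0 = 0" "c 1 = 1" by (simp_all add: c_def)
  have crec: "c (Suc (Suc i)) + 2 * c (Suc i) + c i = c (Suc i)" for i
  proof -
    have "c (Suc (Suc i)) + c (Suc i) + c i
        = (-1) ^ (i + 1) * (hexa (int i + 1 + 1) - hexa (int i + 1) + hexa (int i))"
      by (simp add: c_def algebra_simps)
    then show ?thesis using hexa_rec[of "int i + 1"] by simp
  qed
  have pascal: "int (2 * Suc n choose (n - j)) = t j + 2 * t (Suc j) + t (Suc (Suc j))" if "j \<le> n" for j
  proof (cases "n - j")
    case 0
    then show ?thesis using that by (simp add: t_def)
  next
    case (Suc q)
    show ?thesis
    proof (cases q)
      case 0
      then have "n = Suc j" using Suc by simp
      then show ?thesis by (simp add: t_def)
    next
      case (Suc u)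
      then have "n = j + u + 2" using \<open>n - j = Suc q\<close> by simp
      then show ?thesis by (simp add: t_def)
    qed
  qed
  have "(\<Sum>i\<le>Suc n. int (2 * Suc n choose (Suc n - i)) * c i)
      = (\<Sum>j\<le>n. int (2 * Suc n choose (n - j)) * c (Suc j))"
    by (subst sum.atMost_Suc_shift) (simp add: c0)
  also have "\<dots> = (\<Sum>j\<le>n. (t j + 2 * t (Suc j) + t (Suc (Suc j))) * c (Suc j))"
    by (intro sum.cong refl) (simp only: pascal atMost_iff)
  also have "\<dots> = (\<Sum>j\<le>n. t j * c (Suc j)) + 2 * (\<Sum>j\<le>n. t (Suc j) * c (Suc j))
       + (\<Sum>j\<le>n. t (Suc (Suc j)) * c (Suc j))"
    by (simp add: sum.distrib sum_distrib_left algebra_simps)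
  also have "(\<Sum>j\<le>n. t (Suc j) * c (Suc j)) = (\<Sum>j\<le>n. t j * c j)"
  proof -
    have "(\<Sum>j\<le>Suc n. t j * c j) = (\<Sum>j\<le>n. t (Suc j) * c (Suc j))"
      by (subst sum.atMost_Suc_shift) (simp add: c0)
    then show ?thesis by (simp add: t_def)
  qed
  also have "(\<Sum>j\<le>n. t (Suc (Suc j)) * c (Suc j)) = (\<Sum>j\<le>n. t j * c (j - 1))"
  proof -
    have "(\<Sum>j\<le>Suc (Suc n). t j * c (j - 1)) = (\<Sum>j\<le>n. t (Suc (Suc j)) * c (Suc j))"
      by (simp only: sum.atMost_Suc_shift) (simp add: c0)
    then show ?thesis by (simp add: t_def)
  qed
  also have "(\<Sum>j\<le>n. t j * c (Suc j)) + 2 * (\<Sum>j\<le>n. t j * c j) + (\<Sum>j\<le>n. t j * c (j - 1))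
     = (\<Sum>j\<le>n. t j * (c (Suc j) + 2 * c j + c (j - 1)))"
    by (simp add: sum.distrib sum_distrib_left algebra_simps)
  \<comment> \<open>At j = 0 truncation makes \<open>c (j - 1)\<close> equal to
    \<open>c 0 = 0\<close> instead of the value -1 that the recurrence would need; this defect is
    the new term \<open>t 0\<close>.\<close>
  also have "\<dots> = (\<Sum>j\<le>n. t j * c j + (if j = 0 then t 0 else 0))"
  proof (intro sum.cong refl)
    fix j show "t j * (c (Suc j) + 2 * c j + c (j - 1)) = t j * c j + (if j = 0 then t 0 else 0)"
    proof (cases j)
      case 0
      then show ?thesis using c0 by simp
    next
      case (Suc i)
      then show ?thesis using crec[of i] by simp
    qed
  qed
  also have "\<dots> = (\<Sum>j\<le>n. t j * c j) + t 0" by (simp add: sum.distrib)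
  also have "(\<Sum>j\<le>n. t j * c j) = (\<Sum>k<n. int (2 * k choose k))"
    unfolding Suc by (intro sum.cong refl) (simp add: t_def c_def)
  finally show ?case by (simp add: c_def t_def)
qed simp

subsection \<open>Bernoulli polynomials\<close>

lemma bernoulli_0 [simp]: "bernoulli 0 = 1"
  by (subst bernoulli.simps) simp

lemma bernoulli_rec:
  assumes "n \<ge> 1"
  shows "bernoulli n = - (\<Sum>k<n. of_nat ((n + 1) choose k) * bernoulli k) / of_nat (n + 1)"
  using assms by (subst bernoulli.simps) simp

definition bernoulli_fps :: "rat fps" where
  "bernoulli_fps = Abs_fps (\<lambda>n. bernoulli n / fact n)"

text \<open>Comparing coefficients gives back the defining recursion, so the series is t/(e^t -
  1).\<close>

lemma bernoulli_fps_mult: "bernoulli_fps * (fps_exp 1 - 1) = fps_X"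
proof (rule fps_ext)
  fix n
  have "(bernoulli_fps * (fps_exp 1 - 1)) $ n
      = (\<Sum>k=0..n. bernoulli k / fact k * (if k = n then 0 else 1 / fact (n - k)))"
    unfolding fps_mult_nth
    by (intro sum.cong refl) (auto simp: bernoulli_fps_def)
  also have "\<dots> = (\<Sum>k<n. of_nat (n choose k) * bernoulli k) / fact n"
    unfolding sum_divide_distrib
    by (rule sum.mono_neutral_cong_right) (auto simp: binomial_fact field_simps)
  also have "\<dots> = fps_X $ n"
  proof (cases n)
    case (Suc m)
    show ?thesis
    proof (cases "m = 0")
      case False
      then have "of_nat (m + 1) * bernoulli m = - (\<Sum>k<m. of_nat ((m + 1) choose k) * bernoulli k)"
        by (subst bernoulli_rec) (auto simp del: of_nat_Suc of_nat_add)
      then have "(\<Sum>k<n. of_nat (n choose k) * bernoulli k) = 0"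
        using Suc by simp
      then show ?thesis using Suc False by simp
    qed (use Suc in simp)
  qed simp
  finally show "(bernoulli_fps * (fps_exp 1 - 1)) $ n = fps_X $ n" .
qed

lemma bernoulli_poly_fps: "(bernoulli_fps * fps_exp x) $ n = bernoulli_poly n x / fact n"
  unfolding fps_mult_nth bernoulli_poly_def sum_divide_distrib
  by (intro sum.cong) (auto simp: bernoulli_fps_def binomial_fact field_simps)

text \<open>Generating functions: (e^((x+1)t) - e^(xt)) t/(e^t - 1) = t e^(xt).\<close>

lemma bernoulli_poly_diff:
  assumes "n \<ge> 1"
  shows "bernoulli_poly n (x + 1) - bernoulli_poly n x = of_nat n * x ^ (n - 1)"
proof -
  have "bernoulli_fps * fps_exp (x + 1) - bernoulli_fps * fps_exp x
      = (bernoulli_fps * (fps_exp 1 - 1)) * fps_exp x"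
    by (simp add: fps_exp_add_mult algebra_simps)
  also have "\<dots> = fps_X * fps_exp x" by (simp add: bernoulli_fps_mult)
  finally have "(bernoulli_fps * fps_exp (x + 1) - bernoulli_fps * fps_exp x) $ n = (fps_X * fps_exp x) $ n"
    by simp
  then have "(bernoulli_poly n (x + 1) - bernoulli_poly n x) / fact n = x ^ (n - 1) / fact (n - 1)"
    using assms by (simp add: bernoulli_poly_fps diff_divide_distrib)
  then have "bernoulli_poly n (x + 1) - bernoulli_poly n x = x ^ (n - 1) / fact (n - 1) * fact n"
    by (simp add: divide_eq_eq)
  then show ?thesis using assms by (simp add: fact_reduce)
qed

text \<open>The generating function satisfies F(-t) = F(t) + t, so it is even beyond index 1. The
  substitution of -t for t is \<open>tw\<close>, which is multiplicative.\<close>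

lemma bernoulli_odd_eq_0:
  assumes "odd n" and "n > 1"
  shows "bernoulli n = 0"
proof -
  define tw :: "rat fps \<Rightarrow> rat fps" where "tw F = Abs_fps (\<lambda>n. (-1) ^ n * F $ n)" for F
  have tw_mult: "tw F * tw G = tw (F * G)" for F G
    by (rule fps_ext)
       (auto simp: tw_def fps_mult_nth sum_distrib_left intro!: sum.cong,
        metis (no_types, lifting) le_add_diff_inverse mult.assoc mult.left_commute power_add)
  have "tw (fps_exp 1 - 1) = fps_exp (-1) - 1"
    by (rule fps_ext) (auto simp: tw_def)
  moreover have "tw fps_X = - fps_X"
    by (rule fps_ext) (auto simp: tw_def)
  ultimately have "tw bernoulli_fps * (fps_exp (-1) - 1) = - fps_X"
    using tw_mult[of bernoulli_fps "fps_exp 1 - 1"] by (simp add: bernoulli_fps_mult)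
  then have "tw bernoulli_fps * (fps_exp (-1) - 1) * fps_exp 1 = - fps_X * fps_exp 1" by simp
  moreover have "(fps_exp (-1) - 1) * fps_exp 1 = 1 - fps_exp (1::rat)"
    by (simp add: algebra_simps fps_exp_add_mult[symmetric])
  ultimately have "tw bernoulli_fps * (1 - fps_exp 1) = - fps_X * fps_exp 1"
    by (simp only: mult.assoc)
  then have "tw bernoulli_fps * (fps_exp 1 - 1) = (bernoulli_fps + fps_X) * (fps_exp 1 - 1)"
    using bernoulli_fps_mult by (simp add: algebra_simps)
  moreover have "fps_exp 1 - 1 \<noteq> (0 :: rat fps)"
  proof
    assume "fps_exp 1 - 1 = (0 :: rat fps)"
    then have "(fps_exp 1 - 1 :: rat fps) $ 1 = 0" by (simp only: fps_zero_nth)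
    then show False by simp
  qed
  ultimately have "tw bernoulli_fps = bernoulli_fps + fps_X" by simp
  then have "tw bernoulli_fps $ n = (bernoulli_fps + fps_X) $ n" by simp
  then have "- (bernoulli n / fact n) = bernoulli n / fact n"
    using assms by (simp add: tw_def bernoulli_fps_def)
  then show ?thesis by simp
qed

subsection \<open>Powers of a quadratic polynomial\<close>

lemma coeff_quadratic_power:
  "coeff ([:0, 1, -1 :: 'a::comm_ring_1:] ^ k) r
     = (if r < k then 0 else (-1) ^ (r + k) * of_nat (k choose (r - k)))"
proof -
  have "[:0, 1, -1 :: 'a:] = monom 1 1 * [:1, -1:]" by (simp add: monom_altdef)
  then have "[:0, 1, -1 :: 'a:] ^ k = monom 1 k * [:1, -1:] ^ k"
    by (simp only: power_mult_distrib monom_power) simp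
  moreover have "coeff ([:1, -1 :: 'a:] ^ k) i = (-1) ^ i * of_nat (k choose i)" for i
  proof (cases "i \<le> k")
    case True
    then show ?thesis by (simp add: coeff_linear_poly_power)
  next
    case False
    have "degree ([:1, -1 :: 'a:] ^ k) \<le> degree [:1, -1 :: 'a:] * k" by (rule degree_power_le)
    also have "\<dots> \<le> 1 * k" by (intro mult_right_mono) (simp_all add: degree_pCons_le)
    finally show ?thesis using False by (simp add: coeff_eq_0 binomial_eq_0)
  qed
  moreover have "(-1) ^ (r - k) = ((-1) ^ (r + k) :: 'a)" if "k \<le> r"
    using that by (simp add: minus_one_power_iff)
  ultimately show ?thesis by (simp add: coeff_monom_mult)
qed

text \<open>The power series 1/(1 - t + t^2) has coefficients \<open>hexa (n + 1)\<close>, so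
  \<open>M\<close> is recovered from its product with this quadratic by convolution.\<close>

lemma coeff_via_hexa:
  fixes M :: "'a::comm_ring_1 poly"
  shows "coeff M r = (\<Sum>i\<le>r. of_int (hexa (int r + 1 - int i)) * coeff ([:1, -1, 1:] * M) i)"
proof (induction r rule: induct_nat_012)
  case 0
  then show ?case by (simp add: coeff_pCons)
next
  case 1
  have "hexa 2 = 1" by (simp add: hexa_def)
  then show ?case by (simp add: coeff_pCons)
next
  case (ge2 r)
  let ?g = "coeff ([:1, -1, 1:] * M)"
  have g: "?g (Suc (Suc r)) = coeff M (Suc (Suc r)) - coeff M (Suc r) + coeff M r"
    by (simp add: coeff_pCons)
  have h: "of_int (hexa (int (Suc (Suc r)) + 1 - int i))
      = (of_int (hexa (int (Suc r) + 1 - int i)) - of_int (hexa (int r + 1 - int i)) :: 'a)" for i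
  proof -
    have "hexa (int (Suc (Suc r)) + 1 - int i) = hexa ((int r + 2 - int i) + 1)"
      "hexa (int (Suc r) + 1 - int i) = hexa (int r + 2 - int i)"
      "hexa (int r + 1 - int i) = hexa ((int r + 2 - int i) - 1)"
      by (rule arg_cong[where f = hexa], simp)+
    then have "hexa (int (Suc (Suc r)) + 1 - int i) = hexa (int (Suc r) + 1 - int i) - hexa (int r + 1 - int i)"
      using hexa_rec[of "int r + 2 - int i"] by linarith
    then have "(of_int (hexa (int (Suc (Suc r)) + 1 - int i)) :: 'a) = of_int (hexa (int (Suc r) + 1 - int i) - hexa (int r + 1 - int i))"
      by (rule arg_cong)
    then show ?thesis by (rule trans) (rule of_int_diff)
  qed
  define B C where "B i = (of_int (hexa (int (Suc r) + 1 - int i)) :: 'a)"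
    and "C i = (of_int (hexa (int r + 1 - int i)) :: 'a)" for i
  have "hexa (- 1) = - 1" by (simp add: hexa_def)
  \<comment> \<open>Both sums may run up to r + 2: the added values are 0 except the last one of
    \<open>C\<close>, which is -1 and delivers the new coefficient.\<close>
  then have bc: "B (Suc (Suc r)) = 0" "C (Suc r) = 0" "C (Suc (Suc r)) = - 1"
    unfolding B_def C_def by simp_all
  have "(\<Sum>i\<le>Suc (Suc r). of_int (hexa (int (Suc (Suc r)) + 1 - int i)) * ?g i)
     = (\<Sum>i\<le>Suc (Suc r). B i * ?g i) - (\<Sum>i\<le>Suc (Suc r). C i * ?g i)"
    unfolding h B_def[symmetric] C_def[symmetric] by (simp only: left_diff_distrib sum_subtractf)
  also have "\<dots> = (\<Sum>i\<le>Suc r. B i * ?g i) - (\<Sum>i\<le>r. C i * ?g i) + ?g (Suc (Suc r))"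
    by (simp only: sum.atMost_Suc[of _ "Suc r"] sum.atMost_Suc[of "\<lambda>i. C i * ?g i" r] bc) simp
  also have "(\<Sum>i\<le>Suc r. B i * ?g i) = coeff M (Suc r)" unfolding B_def by (rule ge2(2)[symmetric])
  also have "(\<Sum>i\<le>r. C i * ?g i) = coeff M r" unfolding C_def by (rule ge2(1)[symmetric])
  finally show ?case unfolding g by simp
qed

subsection \<open>Congruences modulo p between p-integral rationals\<close>

locale prime_gt_3 =
  fixes p :: nat
  assumes prime_p: "prime p" and p_gt_3: "p > 3"
begin

text \<open>The localisation of the integers at \<open>p\<close>, not the ring of p-adic
  integers.\<close>

definition Zp :: "rat set" where
  "Zp = {x. \<exists>u v :: int. v \<noteq> 0 \<and> coprime v (int p) \<and> x = of_int u / of_int v}"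

text \<open>Only the difference is constrained, so the product rules below carry separate
  memberships in \<open>Zp\<close>.\<close>

definition pcong :: "rat \<Rightarrow> rat \<Rightarrow> bool" (infix "\<approx>" 50) where
  "x \<approx> y \<longleftrightarrow> (x - y) / of_nat p \<in> Zp"

lemma p_odd: "odd p"
  using prime_odd_nat[OF prime_p] p_gt_3 by simp

lemma not_3_dvd_p: "\<not> 3 dvd p"
proof
  assume "3 dvd p"
  then have "3 = (1::nat) \<or> 3 = p" using prime_p unfolding prime_nat_iff by blast
  then show False using p_gt_3 by simp
qed

lemma p_ne_0 [simp]: "p \<noteq> 0"
  using p_gt_3 by simp

lemma of_nat_p_ne_0 [simp]: "(of_nat p :: rat) \<noteq> 0"
  using p_gt_3 by simp

lemma Zp_of_int [simp, intro]: "of_int u \<in> Zp"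
  unfolding Zp_def by (intro CollectI exI[of _ u] exI[of _ 1]) simp

lemma Zp_of_nat [simp, intro]: "of_nat n \<in> Zp"
  using Zp_of_int[of "int n"] by simp

lemma Zp_numeral [simp, intro]: "numeral n \<in> Zp"
  using Zp_of_nat[of "numeral n"] by simp

lemma Zp_0 [simp, intro]: "0 \<in> Zp" and Zp_1 [simp, intro]: "1 \<in> Zp"
  using Zp_of_nat[of 0] Zp_of_nat[of 1] by simp_all

lemma Zp_add [intro]:
  assumes "x \<in> Zp" "y \<in> Zp"
  shows "x + y \<in> Zp"
proof -
  obtain a b c d :: int where "b \<noteq> 0" "coprime b (int p)" "x = of_int a / of_int b"
    "d \<noteq> 0" "coprime d (int p)" "y = of_int c / of_int d"
    using assms unfolding Zp_def by blast
  then show ?thesis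
    unfolding Zp_def by (intro CollectI exI[of _ "a * d + c * b"] exI[of _ "b * d"])
      (auto simp: field_simps)
qed

lemma Zp_mult [intro]:
  assumes "x \<in> Zp" "y \<in> Zp"
  shows "x * y \<in> Zp"
proof -
  obtain a b c d :: int where "b \<noteq> 0" "coprime b (int p)" "x = of_int a / of_int b"
    "d \<noteq> 0" "coprime d (int p)" "y = of_int c / of_int d"
    using assms unfolding Zp_def by blast
  then show ?thesis
    unfolding Zp_def by (intro CollectI exI[of _ "a * c"] exI[of _ "b * d"]) auto
qed

lemma Zp_minus [intro]: "x \<in> Zp \<Longrightarrow> - x \<in> Zp"
  using Zp_mult[OF Zp_of_int[of "-1"], of x] by simp

lemma Zp_sum [intro]: "(\<And>i. i \<in> A \<Longrightarrow> f i \<in> Zp) \<Longrightarrow> sum f A \<in> Zp"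
  by (induction A rule: infinite_finite_induct) auto

lemma Zp_power [intro]: "x \<in> Zp \<Longrightarrow> x ^ n \<in> Zp"
  by (induction n) auto

lemma Zp_divide_of_nat:
  assumes "x \<in> Zp" "\<not> p dvd k"
  shows "x / of_nat k \<in> Zp"
proof -
  have "coprime (int k) (int p)"
    using prime_p assms(2) by (metis coprime_commute coprime_int_iff prime_imp_coprime)
  moreover have "k \<noteq> 0" using assms(2) by (metis dvd_0_right)
  ultimately have "1 / of_nat k \<in> Zp"
    unfolding Zp_def by (intro CollectI exI[of _ 1] exI[of _ "int k"]) auto
  from Zp_mult[OF assms(1) this] show ?thesis by simp
qed

lemma not_p_dvd: "0 < k \<Longrightarrow> k < p \<Longrightarrow> \<not> p dvd k"
  by (auto dest: dvd_imp_le)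

lemma Zp_divide_lt: "x \<in> Zp \<Longrightarrow> 0 < k \<Longrightarrow> k < p \<Longrightarrow> x / of_nat k \<in> Zp"
  using Zp_divide_of_nat not_p_dvd by blast

lemma not_p_dvd_fact: "k < p \<Longrightarrow> \<not> p dvd fact k"
  using prime_dvd_fact_iff[OF prime_p] by simp

lemma Zp_fact [simp, intro]: "fact k \<in> Zp"
  using Zp_of_nat[of "fact k"] by simp

lemma Zp_divide_fact: "x \<in> Zp \<Longrightarrow> k < p \<Longrightarrow> x / fact k \<in> Zp"
  using Zp_divide_of_nat[of x "fact k"] not_p_dvd_fact by simp

lemma Zp_2 [simp]: "x \<in> Zp \<Longrightarrow> x / 2 \<in> Zp"
  using Zp_divide_lt[of x 2] p_gt_3 by simp

lemma Zp_3 [simp]: "x \<in> Zp \<Longrightarrow> x / 3 \<in> Zp"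
  using Zp_divide_lt[of x 3] p_gt_3 by simp

section \<open>Rules of calculation for congruences\<close>

lemma pcong_refl [simp, intro]: "x \<approx> x"
  by (simp add: pcong_def)

lemma pcong_sym: "x \<approx> y \<Longrightarrow> y \<approx> x"
  unfolding pcong_def using Zp_minus[of "(x - y) / of_nat p"] by (simp add: minus_divide_left)

lemma pcong_trans [trans]: "x \<approx> y \<Longrightarrow> y \<approx> z \<Longrightarrow> x \<approx> z"
  unfolding pcong_def using Zp_add[of "(x - y) / of_nat p" "(y - z) / of_nat p"]
  by (simp add: diff_divide_distrib)

lemma pcong_add: "a \<approx> b \<Longrightarrow> c \<approx> d \<Longrightarrow> a + c \<approx> b + d"
  unfolding pcong_def using Zp_add[of "(a - b) / of_nat p" "(c - d) / of_nat p"]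
  by (simp add: add_divide_distrib diff_divide_distrib add_diff_add)

lemma pcong_minus: "a \<approx> b \<Longrightarrow> - a \<approx> - b"
  unfolding pcong_def using Zp_minus[of "(a - b) / of_nat p"]
  by (simp add: minus_divide_left)

lemma pcong_diff: "a \<approx> b \<Longrightarrow> c \<approx> d \<Longrightarrow> a - c \<approx> b - d"
  using pcong_add[of a b "- c" "- d"] pcong_minus[of c d] by simp

lemma pcong_lmult: "c \<in> Zp \<Longrightarrow> a \<approx> b \<Longrightarrow> c * a \<approx> c * b"
  unfolding pcong_def using Zp_mult[of c "(a - b) / of_nat p"]
  by (simp add: right_diff_distrib)

lemma pcong_rmult: "c \<in> Zp \<Longrightarrow> a \<approx> b \<Longrightarrow> a * c \<approx> b * c"
  using pcong_lmult[of c a b] by (simp add: mult.commute)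

lemma pcong_mult: "a \<approx> b \<Longrightarrow> c \<approx> d \<Longrightarrow> a \<in> Zp \<Longrightarrow> d \<in> Zp \<Longrightarrow> a * c \<approx> b * d"
  by (rule pcong_trans[OF pcong_lmult pcong_rmult])

lemma pcong_sum: "(\<And>i. i \<in> A \<Longrightarrow> f i \<approx> g i) \<Longrightarrow> sum f A \<approx> sum g A"
  by (induction A rule: infinite_finite_induct) (auto intro: pcong_add)

lemma pcong_Zp: "a \<approx> b \<Longrightarrow> b \<in> Zp \<Longrightarrow> a \<in> Zp"
  unfolding pcong_def using Zp_add[OF Zp_mult[OF Zp_of_nat[of p]], of "(a - b) / of_nat p" b] by simp

lemma pcong_mult': "a \<approx> b \<Longrightarrow> c \<approx> d \<Longrightarrow> b \<in> Zp \<Longrightarrow> d \<in> Zp \<Longrightarrow> a * c \<approx> b * d"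
  using pcong_mult[of a b c d] pcong_Zp[of a b] by blast

lemma pcong_power: "a \<approx> b \<Longrightarrow> b \<in> Zp \<Longrightarrow> a ^ n \<approx> b ^ n"
  by (induction n) (auto intro!: pcong_mult intro: pcong_Zp)

lemma pcong_divide_lt: "a \<approx> b \<Longrightarrow> 0 < k \<Longrightarrow> k < p \<Longrightarrow> a / of_nat k \<approx> b / of_nat k"
  using pcong_lmult[of "1 / of_nat k" a b] Zp_divide_lt[of 1 k] by simp

lemma pcong_iff_diff: "a \<approx> b \<longleftrightarrow> a - b \<approx> 0"
  by (simp add: pcong_def)

lemma pcong_diff_0: "a \<approx> b \<Longrightarrow> a - b \<approx> 0"
  by (simp add: pcong_def)

lemma pcong_p_mult: "x \<in> Zp \<Longrightarrow> of_nat p * x \<approx> 0"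
  by (simp add: pcong_def)

lemma pcong_inverse:
  assumes "a \<approx> b" "1 / a \<in> Zp" "1 / b \<in> Zp" "a \<noteq> 0" "b \<noteq> 0"
  shows "1 / a \<approx> 1 / b"
proof -
  have "(1 / a * (1 / b)) * b \<approx> (1 / a * (1 / b)) * a"
    by (intro pcong_lmult pcong_sym[OF assms(1)] Zp_mult assms)
  then show ?thesis using assms by simp
qed

lemma pcong_halve: "2 * x \<approx> 0 \<Longrightarrow> x \<approx> 0"
  using pcong_lmult[of "1/2" "2 * x" 0] Zp_2[of 1] by simp

lemma of_nat_p_minus: "k \<le> p \<Longrightarrow> of_nat (p - k) \<approx> - of_nat k"
  by (simp add: pcong_def of_nat_diff)

lemma pcong_of_int_dvd:
  assumes "int p dvd a - b"
  shows "of_int a \<approx> of_int b"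
proof -
  obtain c where "a - b = int p * c" using assms by blast
  then have "(of_int a - of_int b :: rat) = of_nat p * of_int c"
    by (metis of_int_diff of_int_mult of_int_of_nat_eq)
  then show ?thesis by (simp add: pcong_def)
qed

subsection \<open>Factorials and power sums modulo p\<close>

lemma wilson: "fact (p - 1) \<approx> - 1"
proof -
  have "[fact (p - 1) = - 1] (mod int p)"
    using wilson_theorem[OF prime_p] by simp
  then have "int p dvd fact (p - 1) - (- 1)" by (simp only: cong_iff_dvd_diff)
  from pcong_of_int_dvd[OF this] show ?thesis by simp
qed

text \<open>Wilson's theorem is the case a = 0. As p = q + a + 2, two consecutive products add up to
  p q! a!, so the sign alternates.\<close>

lemma fact_reflect: "a < p \<Longrightarrow> fact (p - 1 - a) * fact a \<approx> (-1) ^ (a + 1)"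
proof (induction a)
  case 0
  then show ?case using wilson by simp
next
  case (Suc a)
  define q where "q = p - 1 - Suc a"
  have q: "p - 1 - a = Suc q" "p = q + a + 2" using Suc.prems by (auto simp: q_def)
  have "fact q * fact (Suc a) + fact (Suc q) * fact a = (of_nat p * (fact q * fact a) :: rat)"
    unfolding q(2) by (simp add: algebra_simps)
  then have "fact q * fact (Suc a) + fact (Suc q) * fact a \<approx> 0"
    using pcong_p_mult[of "fact q * fact a"] by auto
  moreover have "fact (Suc q) * fact a \<approx> (-1) ^ (a + 1)"
    using Suc q by simp
  ultimately have "fact q * fact (Suc a) + fact (Suc q) * fact a - fact (Suc q) * fact a \<approx> 0 - (-1) ^ (a + 1)"
    by (rule pcong_diff)
  then show ?case by (simp add: q_def)
qed

lemma fact_p_minus: "a < p \<Longrightarrow> fact (p - 1 - a) \<approx> (-1) ^ (a + 1) / fact a"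
  using pcong_rmult[OF _ fact_reflect, of "1 / fact a" a] Zp_divide_fact[of 1 a] by simp

lemma inverse_fact_p_minus: "a < p \<Longrightarrow> 1 / fact (p - 1 - a) \<approx> (-1) ^ (a + 1) * fact a"
  using pcong_rmult[OF _ fact_reflect, of "(-1) ^ (a + 1) / fact (p - 1 - a)" a]
    Zp_divide_fact[of "(-1) ^ (a + 1)" "p - 1 - a"] Zp_power[of "-1" "a + 1"] Zp_minus[of 1]
    pcong_sym
  by (simp add: power_add[symmetric] mult_2[symmetric] mult.commute)

lemma fermat:
  assumes "\<not> p dvd a"
  shows "of_nat a ^ (p - 1) \<approx> 1"
proof -
  have "[a ^ (p - 1) = 1] (mod p)" using fermat_theorem[OF prime_p assms] .
  then have "[int (a ^ (p - 1)) = int 1] (mod int p)" by (simp only: cong_int_iff)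
  then have "int p dvd int (a ^ (p - 1)) - int 1" by (simp only: cong_iff_dvd_diff)
  from pcong_of_int_dvd[OF this] show ?thesis by simp
qed

text \<open>Pascal's rule: neighbours in row p - 1 add up to an inner entry of row p, which is
  divisible by p.\<close>

lemma choose_p_minus_1: "k < p \<Longrightarrow> of_nat ((p - 1) choose k) \<approx> (-1) ^ k"
proof (induction k)
  case (Suc k)
  have "(p - 1 choose k) + (p - 1 choose Suc k) = (p choose Suc k)"
    using p_gt_3 by (cases p) auto
  moreover have "p dvd (p choose Suc k)"
    using prime_p Suc.prems by (intro dvd_choose_prime) auto
  ultimately obtain c where "(p - 1 choose k) + (p - 1 choose Suc k) = p * c" by (metis dvdE)
  then have "of_nat (p - 1 choose k) + of_nat (p - 1 choose Suc k) = (of_nat p * of_nat c :: rat)"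
    by (metis of_nat_add of_nat_mult)
  then have "of_nat (p - 1 choose k) + of_nat (p - 1 choose Suc k) \<approx> 0"
    using pcong_p_mult[of "of_nat c"] by simp
  from pcong_diff[OF this Suc.IH] show ?case using Suc.prems by simp
qed simp

section \<open>The reflection of k to p - k in sums of inverses\<close>

lemma sum_reflect: "(\<Sum>k=1..p-1. f (p - k)) = (\<Sum>k=1..p-1. f k)" for f :: "nat \<Rightarrow> rat"
  by (rule sum.reindex_bij_witness[where i = "\<lambda>k. p - k" and j = "\<lambda>k. p - k"]) auto

lemma inverse_p_minus: "1 \<le> k \<Longrightarrow> k < p \<Longrightarrow> 1 / of_nat (p - k) \<approx> - (1 / of_nat k)"
  using pcong_inverse[of "of_nat (p - k)" "- of_nat k"] of_nat_p_minus[of k]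
    Zp_divide_lt[of 1 "p - k"] Zp_divide_lt[of 1 k] by (auto intro!: Zp_minus)

lemma inverse_sq_cong:
  assumes "\<not> p dvd j" "\<not> p dvd k" "int p dvd int j - int k \<or> int p dvd int j + int k"
  shows "1 / (of_nat j)\<^sup>2 \<approx> 1 / (of_nat k)\<^sup>2"
proof -
  have "int p dvd (int j - int k) * (int j + int k)" using assms(3) by auto
  also have "(int j - int k) * (int j + int k) = (int j)\<^sup>2 - (int k)\<^sup>2"
    by (simp add: power2_eq_square algebra_simps)
  finally have "(of_nat j)\<^sup>2 \<approx> (of_nat k)\<^sup>2"
    using pcong_of_int_dvd by fastforce
  moreover have "1 / (of_nat i)\<^sup>2 \<in> Zp" "of_nat i \<noteq> (0::rat)" if "\<not> p dvd i" for i
    using Zp_divide_of_nat[OF Zp_divide_of_nat[OF Zp_1 that] that] that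
    by (auto simp: power2_eq_square intro: ccontr)
  ultimately show ?thesis using assms by (intro pcong_inverse) auto
qed

lemma inverse_sq_p_minus: "1 \<le> k \<Longrightarrow> k < p \<Longrightarrow> 1 / (of_nat (p - k))\<^sup>2 \<approx> 1 / (of_nat k)\<^sup>2"
  by (intro inverse_sq_cong not_p_dvd) (auto simp: of_nat_diff)

lemma sum_sq_reflect:
  assumes "\<And>k. 1 \<le> k \<Longrightarrow> k < p \<Longrightarrow> c k \<in> Zp"
  shows "(\<Sum>k=1..p-1. c (p - k) / (of_nat k)\<^sup>2) \<approx> (\<Sum>k=1..p-1. c k / (of_nat k)\<^sup>2)"
proof -
  have "(\<Sum>k=1..p-1. c k / (of_nat k)\<^sup>2) = (\<Sum>k=1..p-1. c (p - k) / (of_nat (p - k))\<^sup>2)"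
    by (rule sum_reflect[symmetric])
  also have "\<dots> \<approx> (\<Sum>k=1..p-1. c (p - k) / (of_nat k)\<^sup>2)"
  proof (rule pcong_sum)
    fix k assume "k \<in> {1..p-1}"
    then have k: "1 \<le> k" "k < p" using p_gt_3 by auto
    then have "c (p - k) * (1 / (of_nat (p - k))\<^sup>2) \<approx> c (p - k) * (1 / (of_nat k)\<^sup>2)"
      by (intro pcong_lmult inverse_sq_p_minus assms) auto
    then show "c (p - k) / (of_nat (p - k))\<^sup>2 \<approx> c (p - k) / (of_nat k)\<^sup>2" by simp
  qed
  finally show ?thesis by (rule pcong_sym)
qed

section \<open>Harmonic numbers modulo p\<close>

definition H :: "nat \<Rightarrow> rat" where "H n = (\<Sum>i=1..n. 1 / of_nat i)"

lemma H_0 [simp]: "H 0 = 0" and H_Suc [simp]: "H (Suc n) = H n + 1 / of_nat (Suc n)"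
  by (simp_all add: H_def)

lemma Zp_H: "n < p \<Longrightarrow> H n \<in> Zp"
  unfolding H_def by (intro Zp_sum Zp_divide_lt) auto

text \<open>Pairing k with p - k makes the sum congruent to its own negative, and 2 is
  invertible.\<close>

lemma H_p_minus_1: "H (p - 1) \<approx> 0"
proof -
  have "(\<Sum>k=1..p-1. 1 / of_nat (p - k)) \<approx> (\<Sum>k=1..p-1. - (1 / of_nat k))"
  proof (rule pcong_sum)
    fix k assume "k \<in> {1..p-1}"
    then have "1 \<le> k" "k < p" using p_gt_3 by auto
    then show "1 / of_nat (p - k) \<approx> - (1 / of_nat k)" by (rule inverse_p_minus)
  qed
  moreover have "(\<Sum>k=1..p-1. 1 / of_nat (p - k)) = H (p - 1)"
    unfolding H_def using sum_reflect[of "\<lambda>k. 1 / of_nat k"] .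
  moreover have "(\<Sum>k=1..p-1. - (1 / of_nat k)) = - H (p - 1)"
    unfolding H_def by (rule sum_negf)
  ultimately have "H (p - 1) \<approx> - H (p - 1)" by (simp only:)
  then have "H (p - 1) - - H (p - 1) \<approx> 0" by (rule pcong_iff_diff[THEN iffD1])
  then have "2 * H (p - 1) \<approx> 0" by (simp only: mult_2 diff_minus_eq_add)
  then show ?thesis by (rule pcong_halve)
qed

lemma H_reflect: "d < p \<Longrightarrow> H (p - 1 - d) \<approx> H d"
proof (induction d)
  case 0
  then show ?case using H_p_minus_1 by simp
next
  case (Suc d)
  define q where "q = p - 1 - Suc d"
  have q: "p - 1 - d = Suc q" "p - Suc d = Suc q" using Suc.prems by (auto simp: q_def)
  have "H (Suc q) - 1 / of_nat (Suc q) \<approx> H d - (- (1 / of_nat (Suc d)))"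
    using Suc inverse_p_minus[of "Suc d"] unfolding q by (intro pcong_diff) auto
  then show ?case by (simp add: q_def)
qed

section \<open>Bernoulli numbers and power sums modulo p\<close>

lemma Zp_bernoulli: "n + 1 < p \<Longrightarrow> bernoulli n \<in> Zp"
proof (induction n rule: less_induct)
  case (less n)
  show ?case
  proof (cases "n = 0")
    case False
    have "- (\<Sum>k<n. of_nat ((n + 1) choose k) * bernoulli k) / of_nat (n + 1) \<in> Zp"
      using less by (intro Zp_divide_lt Zp_minus Zp_sum Zp_mult Zp_of_nat) auto
    then show ?thesis using False bernoulli_rec[of n] by simp
  qed simp
qed

text \<open>Up to index p - 2 the recursion for Bernoulli numbers divides only by numbers below p,
  so all coefficients are p-integral.\<close>

lemma bernoulli_poly_pcong:
  assumes "x \<approx> y" "y \<in> Zp"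
  shows "bernoulli_poly (p - 2) x \<approx> bernoulli_poly (p - 2) y"
  unfolding bernoulli_poly_def
  by (intro pcong_sum pcong_lmult pcong_power assms Zp_mult Zp_bernoulli Zp_of_nat) (use p_gt_3 in auto)

lemma power_sum_bernoulli:
  "(\<Sum>k<N. (x + of_nat k) ^ (p - 3)) = (bernoulli_poly (p - 2) (x + of_nat N) - bernoulli_poly (p - 2) x) / of_nat (p - 2)"
proof (induction N)
  case (Suc N)
  have "p - 3 = p - 2 - 1" by simp
  then have "bernoulli_poly (p - 2) (x + of_nat (Suc N)) - bernoulli_poly (p - 2) (x + of_nat N)
      = of_nat (p - 2) * (x + of_nat N) ^ (p - 3)"
    using bernoulli_poly_diff[of "p - 2" "x + of_nat N"] p_gt_3 by (simp add: algebra_simps)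
  then have "(x + of_nat N) ^ (p - 3) = (bernoulli_poly (p - 2) (x + of_nat (Suc N)) - bernoulli_poly (p - 2) (x + of_nat N)) / of_nat (p - 2)"
    using p_gt_3 by simp
  then show ?case using Suc by (simp add: diff_divide_distrib)
qed simp

lemma bernoulli_poly_p_minus_2_0: "bernoulli_poly (p - 2) 0 = 0"
proof -
  have "bernoulli_poly (p - 2) 0 = bernoulli (p - 2)"
    unfolding bernoulli_poly_def by (subst sum.remove[of _ "p - 2"]) (auto intro!: sum.neutral)
  then show ?thesis using p_odd p_gt_3 by (simp add: bernoulli_odd_eq_0)
qed

text \<open>The power sum telescopes in the Bernoulli polynomial, whose value at the end point is
  congruent to that at 0, which is 0 because p - 2 is odd and greater than 1. The divisor p - 2 is
  -2 modulo p.\<close>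

lemma power_sum_pcong:
  assumes "x \<in> Zp" "x + of_nat N \<approx> 0"
  shows "2 * (\<Sum>k<N. (x + of_nat k) ^ (p - 3)) \<approx> bernoulli_poly (p - 2) x"
proof -
  have "bernoulli_poly (p - 2) (x + of_nat N) \<approx> bernoulli_poly (p - 2) 0"
    by (intro bernoulli_poly_pcong assms) simp
  then have *: "bernoulli_poly (p - 2) (x + of_nat N) \<approx> 0"
    by (simp only: bernoulli_poly_p_minus_2_0)
  have "- of_nat 2 * (\<Sum>k<N. (x + of_nat k) ^ (p - 3)) \<approx> of_nat (p - 2) * (\<Sum>k<N. (x + of_nat k) ^ (p - 3))"
    using p_gt_3 assms by (intro pcong_rmult pcong_sym[OF of_nat_p_minus]) auto
  also have "\<dots> = bernoulli_poly (p - 2) (x + of_nat N) - bernoulli_poly (p - 2) x"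
    unfolding power_sum_bernoulli using p_gt_3 by simp
  also have "\<dots> \<approx> 0 - bernoulli_poly (p - 2) x" by (intro pcong_diff * pcong_refl)
  finally have "- (- of_nat 2 * (\<Sum>k<N. (x + of_nat k) ^ (p - 3))) \<approx> - (0 - bernoulli_poly (p - 2) x)"
    by (rule pcong_minus)
  then show ?thesis by simp
qed

text \<open>Fermat: x^(p-1) is 1 modulo p, so x^(p-3) represents x^(-2).\<close>

lemma power_p_minus_3:
  assumes "\<not> p dvd a" "\<not> p dvd c"
  shows "(of_nat a / of_nat c) ^ (p - 3) \<approx> (of_nat c)\<^sup>2 / (of_nat a)\<^sup>2"
proof -
  have nz: "(of_nat a :: rat) \<noteq> 0" "(of_nat c :: rat) \<noteq> 0" using assms by (auto intro: ccontr)
  have Zu: "1 / of_nat i ^ n \<in> Zp" if "\<not> p dvd i" for i n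
    using Zp_power[OF Zp_divide_of_nat[OF Zp_1 that], of n] by (simp add: power_one_over)
  have e: "p - 1 = (p - 3) + 2" using p_gt_3 by simp
  have i: "1 / of_nat c ^ (p - 1) \<approx> 1 / 1"
    using nz by (intro pcong_inverse fermat assms Zu) auto
  have "of_nat a ^ (p - 1) * (1 / of_nat c ^ (p - 1)) \<approx> 1 * 1"
    using pcong_mult[OF fermat[OF assms(1)] i] by auto
  then have "((of_nat c)\<^sup>2 * (1 / of_nat a ^ 2)) * (of_nat a ^ (p - 1) * (1 / of_nat c ^ (p - 1))) \<approx> ((of_nat c)\<^sup>2 * (1 / of_nat a ^ 2)) * 1"
    by (intro pcong_lmult Zp_mult Zu assms Zp_power Zp_of_nat) auto
  moreover have "((of_nat c)\<^sup>2 * (1 / of_nat a ^ 2)) * (of_nat a ^ (p - 1) * (1 / of_nat c ^ (p - 1))) = ((of_nat a / of_nat c) ^ (p - 3) :: rat)"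
    unfolding e power_add using nz by (simp add: power_divide)
  ultimately show ?thesis by simp
qed

lemma sum_inverse_sq: "(\<Sum>k=1..p-1. 1 / (of_nat k)\<^sup>2) \<approx> 0"
proof -
  have "(\<Sum>k=1..p-1. 1 / (of_nat k)\<^sup>2) \<approx> (\<Sum>k=1..p-1. (of_nat k) ^ (p - 3))"
  proof (rule pcong_sum, rule pcong_sym)
    fix k assume "k \<in> {1..p-1}"
    then have "0 < k" "k < p" using p_gt_3 by auto
    then have "\<not> p dvd k" "\<not> p dvd 1" using not_p_dvd[of k] not_p_dvd[of 1] p_gt_3 by auto
    from power_p_minus_3[OF this] show "(of_nat k) ^ (p - 3) \<approx> 1 / (of_nat k)\<^sup>2" by simp
  qed
  \<comment> \<open>The added term k = 0 is 0 because the exponent p - 3 is positive.\<close>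
  also have "(\<Sum>k=1..p-1. (of_nat k) ^ (p - 3)) = (\<Sum>k<p. (0 + of_nat k) ^ (p - 3) :: rat)"
    using p_gt_3 by (intro sum.mono_neutral_cong_left) auto
  finally have "2 * (\<Sum>k=1..p-1. 1 / (of_nat k)\<^sup>2) \<approx> 2 * (\<Sum>k<p. (0 + of_nat k) ^ (p - 3))"
    by (intro pcong_lmult) auto
  also have "\<dots> \<approx> bernoulli_poly (p - 2) 0"
    using power_sum_pcong[of 0 p] pcong_p_mult[of 1] by simp
  finally have "2 * (\<Sum>k=1..p-1. 1 / (of_nat k)\<^sup>2) \<approx> 0"
    by (simp only: bernoulli_poly_p_minus_2_0)
  then show ?thesis by (rule pcong_halve)
qed

subsection \<open>Sums of inverse squares and the Bernoulli polynomial\<close>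

text \<open>Write 1/l^2 = 4/(2l)^2 and reduce 2l modulo p to k. If 2l < p then k = 2l is even;
  otherwise k = 2l - p is odd and 2l = p + k.\<close>

lemma sum_sq_double:
  assumes "\<And>k. \<phi> k \<in> Zp"
  shows "(\<Sum>l=1..p-1. \<phi> (2 * l) / (of_nat l)\<^sup>2)
       \<approx> 4 * (\<Sum>k=1..p-1. (if even k then \<phi> k else \<phi> (p + k)) / (of_nat k)\<^sup>2)"
proof -
  define \<beta> where "\<beta> l = (if 2 * l < p then 2 * l else 2 * l - p)" for l
  have "(\<Sum>l=1..p-1. \<phi> (2 * l) / (of_nat l)\<^sup>2) = 4 * (\<Sum>l=1..p-1. \<phi> (2 * l) * (1 / (of_nat (2 * l))\<^sup>2))"
    by (simp add: sum_distrib_left power2_eq_square)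
  also have "\<dots> \<approx> 4 * (\<Sum>l=1..p-1. \<phi> (2 * l) * (1 / (of_nat (\<beta> l))\<^sup>2))"
  proof (intro pcong_lmult pcong_sum Zp_numeral assms inverse_sq_cong)
    fix l assume l: "l \<in> {1..p-1}"
    then have l': "0 < l" "l < p" using p_gt_3 by auto
    have "2 * l \<noteq> p" using p_odd by auto
    then have "0 < \<beta> l" "\<beta> l < p" using l' by (auto simp: \<beta>_def)
    then show "\<not> p dvd \<beta> l" by (rule not_p_dvd)
    have "\<not> p dvd 2" using p_gt_3 by (intro not_p_dvd) auto
    then show "\<not> p dvd 2 * l"
      using not_p_dvd[OF l'] prime_dvd_multD[OF prime_p, of 2 l] by blast
    show "int p dvd int (2 * l) - int (\<beta> l) \<or> int p dvd int (2 * l) + int (\<beta> l)"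
      using l' by (auto simp: \<beta>_def of_nat_diff)
  qed
  also have "(\<Sum>l=1..p-1. \<phi> (2 * l) * (1 / (of_nat (\<beta> l))\<^sup>2))
      = (\<Sum>k=1..p-1. (if even k then \<phi> k else \<phi> (p + k)) / (of_nat k)\<^sup>2)"
  proof (rule sum.reindex_bij_witness[where j = \<beta> and i = "\<lambda>k. if even k then k div 2 else (p + k) div 2"])
    fix l assume l: "l \<in> {1..p-1}"
    have "2 * l \<noteq> p" using p_odd by auto
    then have ne: "0 < \<beta> l" "\<beta> l < p" using l p_gt_3 by (auto simp: \<beta>_def)
    then show "\<beta> l \<in> {1..p-1}" by auto
    have cases: "even (\<beta> l) \<and> \<beta> l = 2 * l \<or> odd (\<beta> l) \<and> p + \<beta> l = 2 * l"
      using p_odd \<open>2 * l \<noteq> p\<close> by (auto simp: \<beta>_def)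
    then show "(if even (\<beta> l) then \<beta> l div 2 else (p + \<beta> l) div 2) = l" by auto
    show "(if even (\<beta> l) then \<phi> (\<beta> l) else \<phi> (p + \<beta> l)) / (of_nat (\<beta> l))\<^sup>2 = \<phi> (2 * l) * (1 / (of_nat (\<beta> l))\<^sup>2)"
      using cases by auto
  next
    fix k assume k: "k \<in> {1..p-1}"
    then have k': "0 < k" "k < p" using p_gt_3 by auto
    show "\<beta> (if even k then k div 2 else (p + k) div 2) = k"
      using k' p_odd by (auto simp: \<beta>_def)
    show "(if even k then k div 2 else (p + k) div 2) \<in> {1..p-1}"
    proof (cases "even k")
      case False
      then have "2 * ((p + k) div 2) = p + k" using p_odd by simp
      then show ?thesis using k' False by auto
    qed (use k' in auto)
  qed
  finally show ?thesis .
qed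

text \<open>Take the power sum from x = 1/3: the end point 1/3 + N = (3N+1)/3 vanishes modulo p, and
  each power (1/3 + k)^(p-3) is congruent to 9/(3k+1)^2. The factor 2 makes this 18.\<close>

lemma bernoulli_third:
  assumes "p dvd 3 * N + 1" "\<And>k. k < N \<Longrightarrow> \<not> p dvd 3 * k + 1"
  shows "bernoulli_poly (p - 2) (1 / 3) \<approx> 18 * (\<Sum>k<N. 1 / (of_nat (3 * k + 1))\<^sup>2)"
proof -
  obtain c where c: "3 * N + 1 = p * c" using assms(1) by blast
  have "(1 / 3 + of_nat N :: rat) = of_nat (3 * N + 1) / 3"
    by (simp add: field_simps)
  also have "\<dots> = of_nat p * (of_nat c / 3)" by (simp only: c of_nat_mult times_divide_eq_right)
  finally have e: "(1 / 3 + of_nat N :: rat) = of_nat p * (of_nat c / 3)" .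
  have "1 / 3 + of_nat N \<approx> 0" unfolding e by (rule pcong_p_mult) simp
  then have "2 * (\<Sum>k<N. (1 / 3 + of_nat k) ^ (p - 3)) \<approx> bernoulli_poly (p - 2) (1 / 3)"
    by (intro power_sum_pcong) auto
  from pcong_sym[OF this]
  have "bernoulli_poly (p - 2) (1 / 3) \<approx> 2 * (\<Sum>k<N. (1 / 3 + of_nat k) ^ (p - 3))" .
  also have "\<dots> \<approx> 2 * (\<Sum>k<N. 9 / (of_nat (3 * k + 1))\<^sup>2)"
  proof (intro pcong_lmult pcong_sum Zp_numeral)
    fix k assume "k \<in> {..<N}"
    then have "\<not> p dvd 3 * k + 1" "\<not> p dvd 3"
      using assms(2) not_p_dvd[of 3] p_gt_3 by auto
    from power_p_minus_3[OF this]
    have "(of_nat (3 * k + 1) / of_nat 3) ^ (p - 3) \<approx> (of_nat 3)\<^sup>2 / (of_nat (3 * k + 1))\<^sup>2" .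
    moreover have "of_nat (3 * k + 1) / of_nat 3 = (1 / 3 + of_nat k :: rat)" by (simp add: field_simps)
    moreover have "(of_nat 3)\<^sup>2 = (9 :: rat)" by simp
    ultimately show "(1 / 3 + of_nat k) ^ (p - 3) \<approx> 9 / (of_nat (3 * k + 1))\<^sup>2" by (simp only:)
  qed
  also have "2 * (\<Sum>k<N. 9 / (of_nat (3 * k + 1))\<^sup>2) = 18 * (\<Sum>k<N. 1 / (of_nat (3 * k + 1))\<^sup>2 :: rat)"
    by (simp add: sum_distrib_left)
  finally show ?thesis .
qed

lemma bernoulli_third_1:
  assumes "p mod 3 = 1"
  shows "bernoulli_poly (p - 2) (1 / 3) \<approx> 18 * (\<Sum>k=1..p-1. of_bool (k mod 3 = 1) / (of_nat k)\<^sup>2)"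
proof -
  define N where "N = p div 3"
  have p3: "p = 3 * N + 1" using assms unfolding N_def by presburger
  have "(\<Sum>k<N. 1 / (of_nat (3 * k + 1))\<^sup>2)
      = (\<Sum>k\<in>{k\<in>{1..p-1}. k mod 3 = 1}. 1 / (of_nat k)\<^sup>2 :: rat)"
  proof (rule sum.reindex_bij_witness[where j = "\<lambda>k. 3 * k + 1" and i = "\<lambda>j. j div 3"])
    fix k assume k: "k \<in> {k\<in>{1..p-1}. k mod 3 = 1}"
    then show "3 * (k div 3) + 1 = k" by simp presburger
    then show "k div 3 \<in> {..<N}" using k p3 by simp
  next
    fix k assume "k \<in> {..<N}"
    moreover have "(3 * k + 1) mod 3 = 1" by presburger
    ultimately show "3 * k + 1 \<in> {k\<in>{1..p-1}. k mod 3 = 1}" using p3 by auto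
  qed auto
  also have "\<dots> = (\<Sum>k=1..p-1. of_bool (k mod 3 = 1) / (of_nat k)\<^sup>2)"
    by (rule sum.mono_neutral_cong_left) auto
  finally have e: "(\<Sum>k<N. 1 / (of_nat (3 * k + 1))\<^sup>2) = (\<Sum>k=1..p-1. of_bool (k mod 3 = 1) / (of_nat k)\<^sup>2 :: rat)" .
  have "p dvd 3 * N + 1" using p3 by simp
  moreover have "\<not> p dvd 3 * k + 1" if "k < N" for k
    using that p3 by (intro not_p_dvd) auto
  ultimately show ?thesis unfolding e[symmetric] by (rule bernoulli_third)
qed

text \<open>Here 3N + 1 = 2p, so 3k + 1 passes p; beyond p, subtracting p leads to residue 2 modulo
  3. Thus both nonzero classes modulo 3 are covered.\<close>

lemma bernoulli_third_2:
  assumes "p mod 3 = 2"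
  shows "bernoulli_poly (p - 2) (1 / 3) \<approx> 18 * (\<Sum>k=1..p-1. of_bool (k mod 3 \<noteq> 0) / (of_nat k)\<^sup>2)"
proof -
  define \<beta> where "\<beta> k = (if 3 * k + 1 < p then 3 * k + 1 else 3 * k + 1 - p)" for k
  define N where "N = 2 * p div 3"
  have p3: "2 * p = 3 * N + 1" using assms unfolding N_def by presburger
  have k1: "3 * k + 1 \<noteq> p" for k using assms by presburger
  have \<beta>: "0 < \<beta> k \<and> \<beta> k < p" if "k < N" for k
    using that p3 k1[of k] by (auto simp: \<beta>_def)
  have nd: "\<not> p dvd 3 * k + 1" if "k < N" for k
  proof
    assume "p dvd 3 * k + 1"
    then have "p dvd \<beta> k" by (auto simp: \<beta>_def intro: dvd_diff_nat)
    then show False using \<beta>[OF that] by (auto dest: dvd_imp_le)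
  qed
  have "bernoulli_poly (p - 2) (1 / 3) \<approx> 18 * (\<Sum>k<N. 1 / (of_nat (3 * k + 1))\<^sup>2)"
    using p3 nd by (intro bernoulli_third dvdI[of _ _ 2]) auto
  also have "\<dots> \<approx> 18 * (\<Sum>k<N. 1 / (of_nat (\<beta> k))\<^sup>2)"
  proof (intro pcong_lmult pcong_sum Zp_numeral inverse_sq_cong)
    fix k assume "k \<in> {..<N}"
    then have k: "k < N" by simp
    show "\<not> p dvd 3 * k + 1" using nd[OF k] .
    show "\<not> p dvd \<beta> k" using \<beta>[OF k] not_p_dvd by blast
    show "int p dvd int (3 * k + 1) - int (\<beta> k) \<or> int p dvd int (3 * k + 1) + int (\<beta> k)"
      using k1[of k] by (auto simp: \<beta>_def of_nat_diff)
  qed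
  also have "(\<Sum>k<N. 1 / (of_nat (\<beta> k))\<^sup>2) = (\<Sum>k\<in>{k\<in>{1..p-1}. k mod 3 \<noteq> 0}. 1 / (of_nat k)\<^sup>2 :: rat)"
  proof (rule sum.reindex_bij_witness[where j = \<beta> and i = "\<lambda>j. if j mod 3 = 1 then j div 3 else (j + p) div 3"])
    fix k assume "k \<in> {..<N}"
    then have k: "k < N" by simp
    have c: "\<beta> k mod 3 = 1 \<and> \<beta> k = 3 * k + 1 \<or> \<beta> k mod 3 = 2 \<and> \<beta> k + p = 3 * k + 1"
      using assms k1[of k] unfolding \<beta>_def by (cases "3 * k + 1 < p") (simp_all, presburger+)
    then show "(if \<beta> k mod 3 = 1 then \<beta> k div 3 else (\<beta> k + p) div 3) = k" by auto
    show "\<beta> k \<in> {k\<in>{1..p-1}. k mod 3 \<noteq> 0}" using c \<beta>[OF k] by auto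
    show "1 / (of_nat (\<beta> k))\<^sup>2 = (1 / (of_nat (\<beta> k))\<^sup>2 :: rat)" ..
  next
    fix j assume "j \<in> {k\<in>{1..p-1}. k mod 3 \<noteq> 0}"
    then have j: "0 < j" "j < p" "j mod 3 = 1 \<or> j mod 3 = 2" by auto
    define m where "m = (if j mod 3 = 1 then j div 3 else (j + p) div 3)"
    have "j mod 3 = 1 \<and> j = 3 * m + 1 \<or> j mod 3 = 2 \<and> j + p = 3 * m + 1"
      using j(3) assms unfolding m_def by (auto; presburger)
    then have "\<beta> m = j" "m < N" using j p3 by (auto simp: \<beta>_def)
    then show "\<beta> (if j mod 3 = 1 then j div 3 else (j + p) div 3) = j"
      and "(if j mod 3 = 1 then j div 3 else (j + p) div 3) \<in> {..<N}"
      unfolding m_def by auto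
  qed
  also have "\<dots> = (\<Sum>k=1..p-1. of_bool (k mod 3 \<noteq> 0) / (of_nat k)\<^sup>2)"
    by (rule sum.mono_neutral_cong_left) auto
  finally show ?thesis .
qed

text \<open>Weights of period 6 suffice for \<open>S\<close>, for the Bernoulli value and for the
  doubling relation, so comparing them becomes linear algebra in these six sums.\<close>

definition class_sum :: "nat \<Rightarrow> rat" where
  "class_sum j = (\<Sum>k=1..p-1. of_bool (k mod 6 = j) / (of_nat k)\<^sup>2)"

lemma sum_sq_classes:
  assumes "\<And>k. \<phi> k = f (k mod 6)"
  shows "(\<Sum>k=1..p-1. \<phi> k / (of_nat k)\<^sup>2) = f 0 * class_sum 0 + f 1 * class_sum 1 + f 2 * class_sum 2 + f 3 * class_sum 3 + f 4 * class_sum 4 + f 5 * class_sum 5"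
proof -
  have "\<phi> k = f 0 * of_bool (k mod 6 = 0) + f 1 * of_bool (k mod 6 = 1) + f 2 * of_bool (k mod 6 = 2)
      + f 3 * of_bool (k mod 6 = 3) + f 4 * of_bool (k mod 6 = 4) + f 5 * of_bool (k mod 6 = 5)" for k
  proof -
    have "k mod 6 \<in> {0, 1, 2, 3, 4, 5}" by auto
    then show ?thesis unfolding assms by auto
  qed
  then show ?thesis
    by (simp only: add_divide_distrib sum.distrib class_sum_def sum_distrib_left times_divide_eq_right)
qed

lemma class_sum_reflect:
  assumes "i < 6" "j < 6" "(i + j) mod 6 = p mod 6"
  shows "class_sum i \<approx> class_sum j"
proof -
  have "(\<Sum>k=1..p-1. of_bool ((p - k) mod 6 = i) / (of_nat k)\<^sup>2) \<approx> class_sum i"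
    unfolding class_sum_def by (rule sum_sq_reflect) auto
  moreover have "(\<Sum>k=1..p-1. of_bool ((p - k) mod 6 = i) / (of_nat k)\<^sup>2) = class_sum j"
    unfolding class_sum_def
  proof (intro sum.cong refl arg_cong2[where f = "(/)"] arg_cong[where f = of_bool])
    fix k assume "k \<in> {1..p-1}"
    then have "p = (p - k) + k" using p_gt_3 by auto
    then obtain m where m: "p - k = m" "p = m + k" by blast
    have "(m + k) mod 6 = (i + j) mod 6" using assms m by simp
    then have c: "[m + k = i + j] (mod 6)" by (simp add: cong_def)
    have "[m = i] (mod 6) \<longleftrightarrow> [k = j] (mod 6)"
    proof
      assume "[m = i] (mod 6)"
      then have "[m + k = m + j] (mod 6)"
        using cong_trans[OF c cong_add[OF cong_sym cong_refl]] by blast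
      then show "[k = j] (mod 6)" by (simp only: cong_add_lcancel_nat)
    next
      assume "[k = j] (mod 6)"
      then have "[m + k = i + k] (mod 6)"
        using cong_trans[OF c cong_add[OF cong_refl cong_sym]] by blast
      then show "[m = i] (mod 6)" by (simp only: cong_add_rcancel_nat)
    qed
    then show "((p - k) mod 6 = i) = (k mod 6 = j)" unfolding m(1) using assms(1,2) by (simp add: cong_def)
  qed
  ultimately show ?thesis using pcong_sym[of "class_sum j" "class_sum i"] by (simp only:)
qed

definition S :: rat where "S = (\<Sum>k=1..p-1. of_int (hexa (int k)) / (of_nat k)\<^sup>2)"

lemma S_classes: "S = class_sum 1 + class_sum 2 - class_sum 4 - class_sum 5"
proof -
  have "hexa (int k) = hexa (int (k mod 6))" for k
  proof -
    have "int k = 6 * int (k div 6) + int (k mod 6)" by (simp add: zdiv_int zmod_int)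
    then show ?thesis using hexa_add_mult6[of "int (k div 6)" "int (k mod 6)"] by (simp only:)
  qed
  then have "of_int (hexa (int k)) = (of_int (hexa (int (k mod 6))) :: rat)" for k
    by (rule arg_cong)
  from sum_sq_classes[where f = "\<lambda>k. of_int (hexa (int k))", OF this]
  have "S = of_int (hexa (int 0)) * class_sum 0 + of_int (hexa (int 1)) * class_sum 1 + of_int (hexa (int 2)) * class_sum 2
      + of_int (hexa (int 3)) * class_sum 3 + of_int (hexa (int 4)) * class_sum 4 + of_int (hexa (int 5)) * class_sum 5"
    unfolding S_def .
  moreover have "hexa (int 0) = 0" "hexa (int 1) = 1" "hexa (int 2) = 1" "hexa (int 3) = 0"
    "hexa (int 4) = -1" "hexa (int 5) = -1"
    by (simp_all add: hexa_def)
  ultimately show ?thesis by simp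
qed

lemma sum_class_sums: "class_sum 0 + class_sum 1 + class_sum 2 + class_sum 3 + class_sum 4 + class_sum 5 \<approx> 0"
  using sum_inverse_sq sum_sq_classes[of "\<lambda>_. 1" "\<lambda>_. 1"] by simp

text \<open>Four relations are combined: the Bernoulli value in terms of class sums, reflection, the
  vanishing total, and doubling for the multiples of 3, where 3 divides 2l exactly when it divides
  l.\<close>

lemma bernoulli_third_S: "bernoulli_poly (p - 2) (1 / 3) \<approx> 12 * S"
proof -
  define b where "b = bernoulli_poly (p - 2) (1 / 3)"
  have dup: "class_sum 0 + class_sum 3 \<approx> 4 * (\<Sum>k=1..p-1. (if even k then of_bool (k mod 3 = 0) else of_bool ((p + k) mod 3 = 0)) / (of_nat k)\<^sup>2)"
  proof -
    have "(\<Sum>l=1..p-1. of_bool (2 * l mod 3 = 0) / (of_nat l)\<^sup>2) = class_sum 0 + class_sum 3"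
    proof -
      have "of_bool (2 * l mod 3 = 0) = (of_bool ((l mod 6) mod 3 = 0) :: rat)" for l :: nat
        by (intro arg_cong[where f = of_bool]) presburger
      then show ?thesis by (subst sum_sq_classes[where f = "\<lambda>l. of_bool (l mod 3 = 0)"]) auto
    qed
    then show ?thesis
      using sum_sq_double[of "\<lambda>k. of_bool (k mod 3 = 0)"] by auto
  qed
  have "p mod 6 = 1 \<or> p mod 6 = 5" using p_odd not_3_dvd_p by presburger
  then have "b - 12 * S \<approx> 0"
  proof
    assume p: "p mod 6 = 1"
    have d: "class_sum 0 + class_sum 3 - 4 * (class_sum 0 + class_sum 5) \<approx> 0"
    proof -
      have "p mod 3 = 1" using p by presburger
      then have "(p + k) mod 3 = (1 + k) mod 3" for k by (metis mod_add_left_eq)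
      moreover have "(if even k then k mod 3 = 0 else (1 + k) mod 3 = 0) \<longleftrightarrow> k mod 6 = 0 \<or> k mod 6 = 5" for k :: nat
        by presburger
      ultimately have "(if even k then of_bool (k mod 3 = 0) else of_bool ((p + k) mod 3 = 0))
          = (of_bool (k mod 6 \<in> {0, 5}) :: rat)" for k
        by (smt (verit) insert_iff empty_iff)
      then have "(\<Sum>k=1..p-1. (if even k then of_bool (k mod 3 = 0) else of_bool ((p + k) mod 3 = 0)) / (of_nat k)\<^sup>2)
          = class_sum 0 + class_sum 5"
        by (subst sum_sq_classes[where f = "\<lambda>k. of_bool (k \<in> {0, 5})"]) auto
      then show ?thesis using pcong_diff_0[OF dup] by (simp only:)
    qed
    have b: "b - 18 * (class_sum 1 + class_sum 4) \<approx> 0"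
    proof -
      have "p mod 3 = 1" using p by presburger
      moreover have "(\<Sum>k=1..p-1. of_bool (k mod 3 = 1) / (of_nat k)\<^sup>2) = class_sum 1 + class_sum 4"
        by (subst sum_sq_classes[where f = "\<lambda>k. of_bool (k mod 3 = 1)"]) (auto simp: mod_mod_cancel)
      ultimately show ?thesis using pcong_diff_0[OF bernoulli_third_1] unfolding b_def by (simp only:)
    qed
    have r: "class_sum 0 - class_sum 1 \<approx> 0" "class_sum 2 - class_sum 5 \<approx> 0" "class_sum 3 - class_sum 4 \<approx> 0"
      using class_sum_reflect[of 0 1] class_sum_reflect[of 2 5] class_sum_reflect[of 3 4] p by (auto intro: pcong_diff_0)
    \<comment> \<open>The multipliers solve the linear system that makes this combination
      identically \<open>b - 12 * S\<close>.\<close>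
    have "(b - 18 * (class_sum 1 + class_sum 4)) + 6 * (class_sum 0 + class_sum 3 - 4 * (class_sum 0 + class_sum 5))
        + 12 * (class_sum 0 + class_sum 1 + class_sum 2 + class_sum 3 + class_sum 4 + class_sum 5) + 6 * (class_sum 0 - class_sum 1) - 24 * (class_sum 2 - class_sum 5) - 18 * (class_sum 3 - class_sum 4)
      \<approx> 0 + 6 * 0 + 12 * 0 + 6 * 0 - 24 * 0 - 18 * 0"
      by (intro pcong_add pcong_diff pcong_lmult Zp_numeral b d r sum_class_sums)
    then show ?thesis by (simp add: S_classes algebra_simps)
  next
    assume p: "p mod 6 = 5"
    have d: "class_sum 0 + class_sum 3 - 4 * (class_sum 0 + class_sum 1) \<approx> 0"
    proof -
      have "p mod 3 = 2" using p by presburger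
      then have "(p + k) mod 3 = (2 + k) mod 3" for k by (metis mod_add_left_eq)
      moreover have "(if even k then k mod 3 = 0 else (2 + k) mod 3 = 0) \<longleftrightarrow> k mod 6 = 0 \<or> k mod 6 = 1" for k :: nat
        by presburger
      ultimately have "(if even k then of_bool (k mod 3 = 0) else of_bool ((p + k) mod 3 = 0))
          = (of_bool (k mod 6 \<in> {0, 1}) :: rat)" for k
        by (smt (verit) insert_iff empty_iff)
      then have "(\<Sum>k=1..p-1. (if even k then of_bool (k mod 3 = 0) else of_bool ((p + k) mod 3 = 0)) / (of_nat k)\<^sup>2)
          = class_sum 0 + class_sum 1"
        by (subst sum_sq_classes[where f = "\<lambda>k. of_bool (k \<in> {0, 1})"]) auto
      then show ?thesis using pcong_diff_0[OF dup] by (simp only:)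
    qed
    have b: "b - 18 * (class_sum 1 + class_sum 2 + class_sum 4 + class_sum 5) \<approx> 0"
    proof -
      have "p mod 3 = 2" using p by presburger
      moreover have "(\<Sum>k=1..p-1. of_bool (k mod 3 \<noteq> 0) / (of_nat k)\<^sup>2) = class_sum 1 + class_sum 2 + class_sum 4 + class_sum 5"
        by (subst sum_sq_classes[where f = "\<lambda>k. of_bool (k mod 3 \<noteq> 0)"]) (auto simp: mod_mod_cancel)
      ultimately show ?thesis using pcong_diff_0[OF bernoulli_third_2] unfolding b_def by (simp only:)
    qed
    have r: "class_sum 0 - class_sum 5 \<approx> 0" "class_sum 1 - class_sum 4 \<approx> 0"
      using class_sum_reflect[of 0 5] class_sum_reflect[of 1 4] p by (auto intro: pcong_diff_0)
    have "(b - 18 * (class_sum 1 + class_sum 2 + class_sum 4 + class_sum 5)) - 6 * (class_sum 0 + class_sum 3 - 4 * (class_sum 0 + class_sum 1))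
        + 6 * (class_sum 0 + class_sum 1 + class_sum 2 + class_sum 3 + class_sum 4 + class_sum 5) - 24 * (class_sum 0 - class_sum 5) - 24 * (class_sum 1 - class_sum 4)
      \<approx> 0 - 6 * 0 + 6 * 0 - 24 * 0 - 24 * 0"
      by (intro pcong_add pcong_diff pcong_lmult Zp_numeral b d r sum_class_sums)
    then show ?thesis by (simp add: S_classes algebra_simps)
  qed
  then show ?thesis unfolding b_def by (rule pcong_iff_diff[THEN iffD2])
qed

subsection \<open>The sum of central binomial coefficients\<close>

text \<open>Adding the summands for i and i + 1 gives C(j,i+1)/j = C(j-1,i)/(i+1). The hockey-stick
  sum of these is C(p-1,i+1)/(i+1), congruent to (-1)^(i+1)/(i+1).\<close>

lemma sum_pred_choose_over: "i + 1 < p \<Longrightarrow> (\<Sum>j=1..p-1. of_nat ((j - 1) choose i) / of_nat j) \<approx> (-1) ^ i * H i"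
proof (induction i)
  case 0
  then show ?case using H_p_minus_1 by (simp add: H_def)
next
  case (Suc i)
  let ?h = "\<lambda>i. \<Sum>j=1..p-1. of_nat ((j - 1) choose i) / of_nat j :: rat"
  have t: "of_nat ((j - 1) choose i) / of_nat j + of_nat ((j - 1) choose Suc i) / of_nat j
      = (of_nat ((j - 1) choose i) / of_nat (Suc i) :: rat)" if "j \<in> {1..p-1}" for j
  proof -
    obtain l where j: "j = Suc l" using \<open>j \<in> {1..p-1}\<close> by (cases j) auto
    have "(of_nat (Suc i) * of_nat (j choose Suc i) :: rat) = of_nat j * of_nat (l choose i)"
      using Suc_times_binomial[of i l] unfolding j by (metis of_nat_mult)
    moreover have "of_nat j \<noteq> (0::rat)" "of_nat (Suc i) \<noteq> (0::rat)" unfolding j of_nat_eq_0_iff by simp_all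
    ultimately have "of_nat (j choose Suc i) / of_nat j = (of_nat (l choose i) / of_nat (Suc i) :: rat)"
      by (simp add: field_simps del: of_nat_Suc)
    then show ?thesis unfolding j by (simp add: add_divide_distrib del: of_nat_Suc)
  qed
  have "?h i + ?h (Suc i) = (\<Sum>j=1..p-1. of_nat ((j - 1) choose i)) / of_nat (Suc i)"
    unfolding sum.distrib[symmetric] sum_divide_distrib by (intro sum.cong refl t)
  also have "(\<Sum>j=1..p-1. of_nat ((j - 1) choose i)) = (\<Sum>j\<le>p-2. of_nat (j choose i) :: rat)"
    by (rule sum.reindex_bij_witness[where i = Suc and j = "\<lambda>j. j - 1"]) (use p_gt_3 in auto)
  also have "\<dots> = of_nat ((p - 1) choose Suc i)"
  proof -
    have "Suc (p - 2) = p - 1" using p_gt_3 by simp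
    then show ?thesis using sum_choose_upper[of i "p - 2"] by (simp only: of_nat_sum[symmetric])
  qed
  finally have e: "?h i + ?h (Suc i) = of_nat ((p - 1) choose Suc i) / of_nat (Suc i)" .
  have "of_nat ((p - 1) choose Suc i) / of_nat (Suc i) \<approx> (-1) ^ Suc i / of_nat (Suc i)"
    using Suc.prems by (intro pcong_divide_lt choose_p_minus_1) auto
  then have "(?h i + ?h (Suc i)) - ?h i \<approx> (-1) ^ Suc i / of_nat (Suc i) - (-1) ^ i * H i"
    unfolding e using Suc by (intro pcong_diff) auto
  moreover have "(-1) ^ Suc i / of_nat (Suc i) - (-1) ^ i * H i = (-1) ^ Suc i * H (Suc i)"
    by (simp add: algebra_simps del: of_nat_Suc)
  ultimately show ?case by (simp only: add_diff_cancel_left')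
qed

text \<open>Coefficientwise form of the functional equation \<open>\<Sum>\<^sub>k H\<^sub>k\<^sub>-\<^sub>1 x\<^sup>k/k = - \<Sum>\<^sub>j (1 - x)\<^sup>j/j\<^sup>2\<close> modulo \<open>p\<close>.\<close>
lemma sum_choose_over_sq:
  assumes "1 \<le> k" "k < p"
  shows "(\<Sum>j=1..p-1. of_nat (j choose k) / (of_nat j)\<^sup>2) \<approx> (-1) ^ (k - 1) * H (k - 1) / of_nat k"
proof -
  obtain i where k: "k = Suc i" using assms by (cases k) auto
  have "of_nat (j choose k) / (of_nat j)\<^sup>2 = (of_nat ((j - 1) choose i) / of_nat j / of_nat k :: rat)"
    if "j \<in> {1..p-1}" for j
  proof -
    obtain l where j: "j = Suc l" using \<open>j \<in> {1..p-1}\<close> by (cases j) auto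
    have "(of_nat k * of_nat (j choose k) :: rat) = of_nat j * of_nat (l choose i)"
      using Suc_times_binomial[of i l] unfolding j k by (metis of_nat_mult)
    moreover have "of_nat j \<noteq> (0::rat)" "of_nat k \<noteq> (0::rat)" unfolding j k of_nat_eq_0_iff by simp_all
    ultimately have "of_nat (j choose k) / of_nat j = (of_nat (l choose i) / of_nat k :: rat)"
      by (simp add: field_simps)
    then have "of_nat (j choose k) / of_nat j / of_nat j = (of_nat (l choose i) / of_nat k / of_nat j :: rat)"
      by (rule arg_cong)
    then show ?thesis by (simp add: j power2_eq_square mult.commute del: of_nat_Suc)
  qed
  then have "(\<Sum>j=1..p-1. of_nat (j choose k) / (of_nat j)\<^sup>2) = (\<Sum>j=1..p-1. of_nat ((j - 1) choose i) / of_nat j) / (of_nat k :: rat)"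
    by (simp add: sum_divide_distrib)
  moreover have "(\<Sum>j=1..p-1. of_nat ((j - 1) choose i) / of_nat j) / of_nat k \<approx> (-1) ^ i * H i / of_nat k"
    using assms k by (intro pcong_divide_lt sum_pred_choose_over) auto
  ultimately show ?thesis using k by simp
qed

text \<open>The functional equation at a primitive sixth root of unity z, where 1 - z = z^(-1) turns
  powers of 1 - z back into values of \<open>hexa\<close>. The phase \<open>e\<close> is 0 or -p in
  the applications.\<close>

lemma sum_hexa_H:
  "(\<Sum>k=1..p-1. of_int (hexa (e + int k)) * H (k - 1) / of_nat k)
     \<approx> - (\<Sum>j=1..p-1. of_int (hexa (e - int j)) / (of_nat j)\<^sup>2)"
proof -
  have "(\<Sum>k=1..p-1. of_int (hexa (e + int k)) * H (k - 1) / of_nat k)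
      = (\<Sum>k=1..p-1. ((-1) ^ (k - 1) * of_int (hexa (e + int k))) * ((-1) ^ (k - 1) * H (k - 1) / of_nat k))"
    by (intro sum.cong refl) (simp add: mult.assoc mult.left_commute power_add[symmetric] mult_2[symmetric])
  also have "\<dots> \<approx> (\<Sum>k=1..p-1. ((-1) ^ (k - 1) * of_int (hexa (e + int k))) * (\<Sum>j=1..p-1. of_nat (j choose k) / (of_nat j)\<^sup>2))"
  proof (rule pcong_sum, rule pcong_lmult)
    fix k assume "k \<in> {1..p-1}"
    then have k: "1 \<le> k" "k < p" using p_gt_3 by auto
    show "(-1) ^ (k - 1) * of_int (hexa (e + int k)) \<in> Zp"
      by (intro Zp_mult Zp_power Zp_of_int Zp_minus Zp_1)
    show "(-1) ^ (k - 1) * H (k - 1) / of_nat k \<approx> (\<Sum>j=1..p-1. of_nat (j choose k) / (of_nat j)\<^sup>2)"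
      using sum_choose_over_sq[OF k] by (rule pcong_sym)
  qed
  also have "(\<Sum>k=1..p-1. ((-1) ^ (k - 1) * of_int (hexa (e + int k))) * (\<Sum>j=1..p-1. of_nat (j choose k) / (of_nat j)\<^sup>2))
     = (\<Sum>j=1..p-1. (\<Sum>k=1..p-1. (-1) ^ (k - 1) * of_nat (j choose k) * of_int (hexa (e + int k))) / (of_nat j)\<^sup>2 :: rat)"
    unfolding sum_distrib_left sum_divide_distrib by (subst sum.swap) (simp add: mult_ac)
  \<comment> \<open>Only k = 0 is missing from the full alternating sum. Its share
    \<open>hexa e\<close> then multiplies a sum of inverse squares that vanishes modulo p.\<close>
  also have "\<dots> = (\<Sum>j=1..p-1. (of_int (hexa e) - of_int (hexa (e - int j))) / (of_nat j)\<^sup>2)"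
  proof (intro sum.cong refl arg_cong2[where f = "(/)"])
    fix j assume j: "j \<in> {1..p-1}"
    have "of_int (hexa (e - int j)) = (\<Sum>k\<le>j. (-1) ^ k * of_nat (j choose k) * of_int (hexa (e + int k)) :: rat)"
      by (rule alternating_choose_hexa_sum[symmetric])
    also have "\<dots> = (\<Sum>k\<in>insert 0 {1..p-1}. (-1) ^ k * of_nat (j choose k) * of_int (hexa (e + int k)))"
      using j by (intro sum.mono_neutral_left) (auto simp: binomial_eq_0)
    also have "\<dots> = of_int (hexa e) + (\<Sum>k=1..p-1. - ((-1) ^ (k - 1) * of_nat (j choose k) * of_int (hexa (e + int k))))"
    proof -
      have "(\<Sum>k=1..p-1. (-1) ^ k * of_nat (j choose k) * of_int (hexa (e + int k)))
        = (\<Sum>k=1..p-1. - ((-1) ^ (k - 1) * of_nat (j choose k) * of_int (hexa (e + int k))) :: rat)"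
      proof (intro sum.cong refl)
        fix k assume "k \<in> {1..p-1}"
        then obtain l where "k = Suc l" by (cases k) auto
        then show "(-1) ^ k * of_nat (j choose k) * of_int (hexa (e + int k))
          = - ((-1) ^ (k - 1) * of_nat (j choose k) * of_int (hexa (e + int k)) :: rat)" by simp
      qed
      then show ?thesis by (subst sum.insert) auto
    qed
    finally show "(\<Sum>k=1..p-1. (-1) ^ (k - 1) * of_nat (j choose k) * of_int (hexa (e + int k)))
        = (of_int (hexa e) - of_int (hexa (e - int j)) :: rat)"
      by (simp add: sum_negf)
  qed
  also have "\<dots> = of_int (hexa e) * (\<Sum>j=1..p-1. 1 / (of_nat j)\<^sup>2) - (\<Sum>j=1..p-1. of_int (hexa (e - int j)) / (of_nat j)\<^sup>2)"
    by (simp add: diff_divide_distrib sum_subtractf sum_distrib_left)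
  also have "\<dots> \<approx> of_int (hexa e) * 0 - (\<Sum>j=1..p-1. of_int (hexa (e - int j)) / (of_nat j)\<^sup>2)"
    by (intro pcong_diff pcong_lmult sum_inverse_sq Zp_of_int pcong_refl)
  finally show ?thesis by simp
qed

lemma sum_hexa_H_0: "(\<Sum>k=1..p-1. of_int (hexa (int k)) * H (k - 1) / of_nat k) \<approx> S"
  using sum_hexa_H[of 0] by (simp add: S_def hexa_minus sum_negf)

text \<open>Phase -p: since p is 1 or -1 modulo 6, hexa(p + j) splits into hexa(j) + hexa(p - j),
  and by reflection each part contributes one \<open>S\<close>.\<close>

lemma sum_hexa_p_H: "(\<Sum>k=1..p-1. of_int (hexa (int p - int k)) * H (k - 1) / of_nat k) \<approx> - 2 * S"
proof -
  have h: "hexa (int p + int j) + hexa (int j - int p) = hexa (int j)" for j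
    using hexa_add_diff[of "int p" "int j"] p_odd not_3_dvd_p
    by (simp add: add.commute) (metis int_dvd_int_iff of_nat_numeral)
  have "(\<Sum>k=1..p-1. of_int (hexa (int p - int k)) * H (k - 1) / of_nat k)
      = - (\<Sum>k=1..p-1. of_int (hexa (- int p + int k)) * H (k - 1) / of_nat k)"
    unfolding sum_negf[symmetric]
    by (intro sum.cong refl) (simp add: hexa_minus_diff[of "int p"])
  also have "\<dots> \<approx> - (- (\<Sum>j=1..p-1. of_int (hexa (- int p - int j)) / (of_nat j)\<^sup>2))"
    by (intro pcong_minus sum_hexa_H)
  also have "- (- (\<Sum>j=1..p-1. of_int (hexa (- int p - int j)) / (of_nat j)\<^sup>2))
      = - (\<Sum>j=1..p-1. (of_int (hexa (int j)) - of_int (hexa (int j - int p))) / (of_nat j)\<^sup>2 :: rat)"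
  proof -
    have "of_int (hexa (- int p - int j)) = - (of_int (hexa (int j)) - of_int (hexa (int j - int p)) :: rat)" for j
      using h[of j] hexa_minus[of "int p + int j"] by (simp flip: of_int_diff of_int_minus)
    then show ?thesis by (simp only: divide_minus_left sum_negf minus_minus)
  qed
  also have "\<dots> = - S - (\<Sum>j=1..p-1. of_int (hexa (int p - int j)) / (of_nat j)\<^sup>2)"
    by (simp add: S_def diff_divide_distrib add_divide_distrib sum.distrib sum_subtractf
        hexa_minus_diff[of _ "int p"] sum_negf)
  also have "\<dots> \<approx> - S - S"
  proof (intro pcong_diff pcong_refl)
    have "(\<Sum>j=1..p-1. of_int (hexa (int p - int j)) / (of_nat j)\<^sup>2) = (\<Sum>j=1..p-1. of_int (hexa (int (p - j))) / (of_nat j)\<^sup>2 :: rat)"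
      by (intro sum.cong refl) (auto simp: of_nat_diff)
    then show "(\<Sum>j=1..p-1. of_int (hexa (int p - int j)) / (of_nat j)\<^sup>2) \<approx> S"
      using sum_sq_reflect[of "\<lambda>k. of_int (hexa (int k))"] by (simp add: S_def)
  qed
  finally show ?thesis by simp
qed

text \<open>C(N-1,j) is the product of N/i - 1 over 1 <= i <= j, which is (-1)^j (1 - N H_j) to
  first order in N; N = 2p is compared with N = p.\<close>

lemma choose_2p_minus_choose_p:
  "j < p \<Longrightarrow> (of_nat ((2 * p - 1) choose j) - of_nat ((p - 1) choose j)) / of_nat p \<approx> - ((-1) ^ j * H j)"
proof (induction j)
  case (Suc j)
  define A B :: rat where "A = of_nat ((2 * p - 1) choose j)" and "B = of_nat ((p - 1) choose j)"
  have j0: "of_nat (Suc j) \<noteq> (0::rat)" unfolding of_nat_eq_0_iff by simp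
  have step: "of_nat ((N - 1) choose Suc j) = of_nat ((N - 1) choose j) * (of_nat N / of_nat (Suc j) - 1 :: rat)"
    if "Suc j \<le> N" for N
  proof -
    have "Suc j * ((N - 1) choose Suc j) = (N - 1 - j) * ((N - 1) choose j)"
      using binomial_absorb_comp[of "N - 1" j] by (metis mult.commute binomial_absorption)
    then have "of_nat (Suc j) * of_nat ((N - 1) choose Suc j) = (of_nat (N - 1 - j) * of_nat ((N - 1) choose j) :: rat)"
      by (metis of_nat_mult)
    moreover have "of_nat (N - 1 - j) = (of_nat N - of_nat (Suc j) :: rat)"
      using that by (simp add: of_nat_diff)
    ultimately show ?thesis using j0 by (simp add: field_simps del: of_nat_Suc)
  qed
  have B: "B \<approx> (-1) ^ j" unfolding B_def using Suc.prems by (intro choose_p_minus_1) simp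
  have AB: "(A - B) / of_nat p \<approx> - ((-1) ^ j * H j)" using Suc unfolding A_def B_def by simp
  have "(A - B) / of_nat p \<in> Zp"
    using Suc.prems by (intro pcong_Zp[OF AB] Zp_minus Zp_mult Zp_power Zp_1 Zp_H) auto
  then have "A \<approx> B" by (simp add: pcong_def)
  then have "2 * A - B \<approx> 2 * (-1) ^ j - (-1) ^ j"
    using B by (intro pcong_diff pcong_lmult) (auto intro: pcong_trans)
  then have "2 * A - B \<approx> (-1) ^ j" by simp
  have "(of_nat ((2 * p - 1) choose Suc j) - of_nat ((p - 1) choose Suc j)) / of_nat p
      = - ((A - B) / of_nat p) + (2 * A - B) / of_nat (Suc j)"
  proof -
    have A': "of_nat ((2 * p - 1) choose Suc j) = A * (2 * of_nat p / of_nat (Suc j) - 1)"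
      using step[of "2 * p"] Suc.prems unfolding A_def by simp
    have B': "of_nat ((p - 1) choose Suc j) = B * (of_nat p / of_nat (Suc j) - 1)"
      using step[of p] Suc.prems unfolding B_def by simp
    show ?thesis unfolding A' B' using j0 by (simp add: field_simps del: of_nat_Suc)
  qed
  also have "\<dots> \<approx> - (- ((-1) ^ j * H j)) + (-1) ^ j / of_nat (Suc j)"
    using Suc.prems by (intro pcong_add pcong_minus AB pcong_divide_lt \<open>2 * A - B \<approx> (-1) ^ j\<close>) auto
  also have "\<dots> = - ((-1) ^ Suc j * H (Suc j))" by (simp add: algebra_simps del: of_nat_Suc)
  finally show ?case .
qed simp

lemma sum_central_choose_pcong:
  "((\<Sum>k<p. of_nat (2 * k choose k)) - of_int (hexa (int p))) / (of_nat p)\<^sup>2 \<approx> - 4 * S"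
proof -
  let ?s = "\<lambda>k. of_int (hexa (int p - int k)) :: rat"
  have "(\<Sum>k<p. int (2 * k choose k)) = (\<Sum>k\<le>p. int (2 * p choose k) * ((-1) ^ k * hexa (int p - int k)))"
    unfolding sum_central_choose
  proof (rule sum.reindex_bij_witness[where i = "\<lambda>k. p - k" and j = "\<lambda>k. p - k"])
    fix i assume i: "i \<in> {..p}"
    then have "even (p - i) \<longleftrightarrow> odd i" using p_odd by auto
    then have "(-1) ^ (p - i) = ((-1) ^ (i + 1) :: int)" by (simp add: minus_one_power_iff)
    then show "int (2 * p choose (p - i)) * ((-1) ^ (p - i) * hexa (int p - int (p - i)))
        = int (2 * p choose (p - i)) * ((-1) ^ (i + 1) * hexa (int i))"
      using i by (simp add: of_nat_diff)
  qed auto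
  \<comment> \<open>The end terms are split off: k = p carries \<open>hexa 0 = 0\<close>, and k = 0
    gives the main term \<open>hexa (int p)\<close>.\<close>
  also have "{..p} = insert 0 (insert p {1..p-1})" by auto
  finally have "(\<Sum>k<p. int (2 * k choose k)) = hexa (int p) + (\<Sum>k=1..p-1. int (2 * p choose k) * ((-1) ^ k * hexa (int p - int k)))"
    using p_gt_3 by (subst (asm) sum.insert; (subst (asm) sum.insert)?; auto)
  then have "of_int (\<Sum>k<p. int (2 * k choose k)) = (of_int (hexa (int p) + (\<Sum>k=1..p-1. int (2 * p choose k) * ((-1) ^ k * hexa (int p - int k)))) :: rat)"
    by (rule arg_cong)
  then have c: "(\<Sum>k<p. of_nat (2 * k choose k)) = of_int (hexa (int p)) + (\<Sum>k=1..p-1. of_nat (2 * p choose k) * ((-1) ^ k * ?s k))"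
    by simp
  \<comment> \<open>In row p the inner terms of the expansion of (1 - z)^p cancel exactly.
    Subtracting twice this zero from row 2p leaves the differences C(2p,k) - 2 C(p,k), which are
    divisible by p^2.\<close>
  have z: "(\<Sum>k=1..p-1. of_nat (p choose k) * ((-1) ^ k * ?s k)) = 0"
  proof -
    have "hexa (int p + int p) + hexa (int p - int p) = hexa (int p)"
      using hexa_add_diff[of "int p" "int p"] p_odd not_3_dvd_p
      by simp (metis int_dvd_int_iff of_nat_numeral)
    then have h2: "hexa (- int p - int p) = hexa (- int p)"
      using hexa_minus[of "int p + int p"] hexa_minus[of "int p"] by simp
    have "of_int (hexa (- int p - int p)) = (\<Sum>k\<le>p. (-1) ^ k * of_nat (p choose k) * of_int (hexa (- int p + int k)) :: rat)"
      by (rule alternating_choose_hexa_sum[symmetric])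
    also have "{..p} = insert 0 (insert p {1..p-1})" by auto
    also have "(\<Sum>k\<in>insert 0 (insert p {1..p-1}). (-1) ^ k * of_nat (p choose k) * of_int (hexa (- int p + int k)))
        = of_int (hexa (- int p)) + (\<Sum>k=1..p-1. (-1) ^ k * of_nat (p choose k) * of_int (hexa (- int p + int k)) :: rat)"
      using p_gt_3 by (subst sum.insert; (subst sum.insert)?; auto)
    finally have "(\<Sum>k=1..p-1. (-1) ^ k * of_nat (p choose k) * of_int (hexa (- int p + int k)) :: rat) = 0"
      unfolding h2 by simp
    moreover have "?s k = - of_int (hexa (- int p + int k))" for k
      using hexa_minus_diff[of "int p" "int k"] by simp
    ultimately show ?thesis by (simp add: sum_negf mult_ac)
  qed
  have "((\<Sum>k<p. of_nat (2 * k choose k)) - of_int (hexa (int p))) / (of_nat p)\<^sup>2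
      = (\<Sum>k=1..p-1. (of_nat (2 * p choose k) - 2 * of_nat (p choose k)) / (of_nat p)\<^sup>2 * ((-1) ^ k * ?s k))"
  proof -
    have "(\<Sum>k<p. of_nat (2 * k choose k)) - of_int (hexa (int p))
      = (\<Sum>k=1..p-1. of_nat (2 * p choose k) * ((-1) ^ k * ?s k)) - 2 * (\<Sum>k=1..p-1. of_nat (p choose k) * ((-1) ^ k * ?s k))"
      unfolding c z by simp
    also have "\<dots> = (\<Sum>k=1..p-1. (of_nat (2 * p choose k) - 2 * of_nat (p choose k)) * ((-1) ^ k * ?s k))"
      by (simp add: sum_subtractf sum_distrib_left algebra_simps)
    finally show ?thesis by (simp add: sum_divide_distrib)
  qed
  also have "\<dots> \<approx> (\<Sum>k=1..p-1. 2 * (?s k * H (k - 1) / of_nat k))"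
  proof (rule pcong_sum)
    fix k assume "k \<in> {1..p-1}"
    then obtain j where k: "k = Suc j" "Suc j < p" using p_gt_3 by (cases k) auto
    have k0: "of_nat k \<noteq> (0::rat)" using k by simp
    have ab: "of_nat (N choose k) = (of_nat N / of_nat k * of_nat ((N - 1) choose j) :: rat)" for N
    proof -
      have "(of_nat k * of_nat (N choose k) :: rat) = of_nat N * of_nat ((N - 1) choose j)"
        using binomial_absorption[of j N] unfolding k by (metis of_nat_mult)
      then show ?thesis using k0 by (simp add: field_simps)
    qed
    have "(of_nat (2 * p choose k) - 2 * of_nat (p choose k)) / (of_nat p)\<^sup>2
        = 2 * ((of_nat ((2 * p - 1) choose j) - of_nat ((p - 1) choose j)) / of_nat p) / (of_nat k :: rat)"
      unfolding ab using k0 by (simp add: field_simps power2_eq_square)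
    also have "\<dots> \<approx> 2 * (- ((-1) ^ j * H j)) / of_nat k"
      using k by (intro pcong_divide_lt pcong_lmult choose_2p_minus_choose_p) auto
    finally have "(of_nat (2 * p choose k) - 2 * of_nat (p choose k)) / (of_nat p)\<^sup>2 * ((-1) ^ k * ?s k)
        \<approx> 2 * (- ((-1) ^ j * H j)) / of_nat k * ((-1) ^ k * ?s k)"
      by (intro pcong_rmult Zp_mult Zp_power Zp_of_int Zp_minus Zp_1)
    also have "2 * (- ((-1) ^ j * H j)) / of_nat k * ((-1) ^ k * ?s k) = 2 * (?s k * H (k - 1) / of_nat k)"
    proof -
      have "(-1) ^ j * (-1) ^ j = (1::rat)" by (simp add: power_add[symmetric] mult_2[symmetric])
      then show ?thesis unfolding k(1) by (simp add: mult_ac del: of_nat_Suc)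
    qed
    finally show "(of_nat (2 * p choose k) - 2 * of_nat (p choose k)) / (of_nat p)\<^sup>2 * ((-1) ^ k * ?s k)
        \<approx> 2 * (?s k * H (k - 1) / of_nat k)" .
  qed
  also have "(\<Sum>k=1..p-1. 2 * (?s k * H (k - 1) / of_nat k)) = 2 * (\<Sum>k=1..p-1. ?s k * H (k - 1) / of_nat k)"
    by (simp add: sum_distrib_left)
  also have "\<dots> \<approx> 2 * (- 2 * S)"
    by (intro pcong_lmult sum_hexa_p_H) simp
  finally show ?thesis by simp
qed

subsection \<open>The tail\<close>

text \<open>Without its factor p, (p+r)! is (p-1)! times the residues 1, ..., r, and Wilson supplies
  the sign.\<close>

lemma fact_p_add: "fact (p + r) / of_nat p \<approx> - fact r"
proof (induction r)
  case 0
  have "fact p = (of_nat p * fact (p - 1) :: rat)" using p_gt_3 by (simp add: fact_reduce)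
  then show ?case using wilson by simp
next
  case (Suc r)
  have "of_nat (p + Suc r) \<approx> of_nat (Suc r)" by (simp add: pcong_def)
  then have "of_nat (p + Suc r) * (fact (p + r) / of_nat p) \<approx> of_nat (Suc r) * - fact r"
    using Suc by (intro pcong_mult' Zp_minus) auto
  moreover have "fact (p + Suc r) / of_nat p = of_nat (p + Suc r) * (fact (p + r) / of_nat p :: rat)"
    by (simp only: add_Suc_right fact_Suc) (simp add: algebra_simps)
  ultimately show ?case by (simp add: algebra_simps)
qed

section \<open>The tail as a sum of factorial quotients\<close>

definition half :: nat where "half = (p - 1) div 2"

lemma two_half: "2 * half + 1 = p"
  using p_odd unfolding half_def by presburger

definition \<alpha> :: "nat \<Rightarrow> rat" where "\<alpha> m = (fact m)\<^sup>2 / fact (2 * m + 1)"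

definition \<rho> :: "nat \<Rightarrow> nat \<Rightarrow> rat" where
  "\<rho> m r = fact r * fact (2 * m + 1 + r) / (fact (m + r + 1))\<^sup>2"

definition \<delta> :: "nat \<Rightarrow> rat" where "\<delta> m = (\<Sum>r<p - 1 - 2 * m. \<rho> m r)"

text \<open>The contribution of \<open>j\<close> to \<open>(-1)\<^sup>n f\<^sub>n\<close> for \<open>n = j + i\<close>.\<close>
definition \<tau> :: "nat \<Rightarrow> nat \<Rightarrow> rat" where
  "\<tau> j i = (-1) ^ (j + i) * of_nat (2 * j choose j) * of_nat ((j + i) choose j) * of_nat (j choose i)"

lemma Zp_\<alpha>: "m < half \<Longrightarrow> \<alpha> m \<in> Zp"
  unfolding \<alpha>_def using two_half by (intro Zp_divide_fact Zp_power) auto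

lemma Zp_inverse_fact_sq: "k < p \<Longrightarrow> 1 / (fact k)\<^sup>2 \<in> Zp"
  using Zp_divide_fact[OF Zp_divide_fact[OF Zp_1]] by (simp add: power2_eq_square)

text \<open>Here j = p - 1 - m and j + i = p + r. The two factors p come from (2j)! and (j+i)!; all
  other factorials have arguments below p and are reflected.\<close>

lemma tail_term:
  assumes "r < p - 1 - 2 * m"
  shows "\<tau> (p - 1 - m) (m + 1 + r) / (of_nat p)\<^sup>2 \<approx> - (\<alpha> m * \<rho> m r)"
proof -
  define j where "j = p - 1 - m"
  define i where "i = m + 1 + r"
  define q where "q = p - 1 - (2 * m + 1)"
  define w where "w = p - 1 - (2 * m + 1 + r)"
  have ji: "i \<le> j" "j - i = w" "j + i = p + r" "2 * j = p + q" "2 * m + 1 + r < p" "i < p" "m < p"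
    using assms by (auto simp: j_def i_def q_def w_def)
  have "\<tau> j i = (-1) ^ (p + r) * (fact (p + q) / (fact j * fact j)) * (fact (p + r) / (fact j * fact i)) * (fact j / (fact i * fact w))"
  proof -
    have "of_nat (2 * j choose j) = (fact (p + q) / (fact j * fact j) :: rat)"
      unfolding ji(4)[symmetric] by (subst binomial_fact) auto
    moreover have "of_nat ((j + i) choose j) = (fact (p + r) / (fact j * fact i) :: rat)"
      unfolding ji(3)[symmetric] by (subst binomial_fact) auto
    moreover have "of_nat (j choose i) = (fact j / (fact i * fact w) :: rat)"
      unfolding ji(2)[symmetric] using ji(1) by (rule binomial_fact)
    ultimately show ?thesis unfolding \<tau>_def ji(3)[symmetric] by (simp only:)
  qed
  then have "\<tau> j i / (of_nat p)\<^sup>2 = (-1) ^ (p + r) * ((fact (p + q) / of_nat p) * ((fact (p + r) / of_nat p)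
      * ((1 / fact j) * ((1 / fact j) * ((1 / fact w) * (1 / (fact i)\<^sup>2))))))"
    by (simp add: power2_eq_square)
  also have "\<dots> \<approx> (-1) ^ (p + r) * ((- (1 / fact (2 * m + 1))) * ((- fact r)
      * (((-1) ^ (m + 1) * fact m) * (((-1) ^ (m + 1) * fact m) * (((-1) ^ r * fact (2 * m + 1 + r)) * (1 / (fact i)\<^sup>2))))))"
  proof -
    have 1: "fact (p + q) / of_nat p \<approx> - (1 / fact (2 * m + 1))"
    proof -
      have "fact q \<approx> (-1) ^ (2 * m + 1 + 1) / fact (2 * m + 1)"
        unfolding q_def using ji by (intro fact_p_minus) auto
      then have "- fact q \<approx> - (1 / fact (2 * m + 1))" by (intro pcong_minus) simp
      with fact_p_add[of q] show ?thesis by (rule pcong_trans)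
    qed
    have 2: "1 / fact j \<approx> (-1) ^ (m + 1) * fact m"
      unfolding j_def using ji by (intro inverse_fact_p_minus) auto
    have 3: "1 / fact w \<approx> (-1) ^ r * fact (2 * m + 1 + r)"
    proof -
      have "(-1) ^ (2 * m + 1 + r + 1) = ((-1) ^ r :: rat)" by (simp add: minus_one_power_iff)
      then show ?thesis unfolding w_def using inverse_fact_p_minus[of "2 * m + 1 + r"] ji by simp
    qed
    have z: "1 / fact (2 * m + 1) \<in> Zp" using ji by (intro Zp_divide_fact) auto
    have s: "(-1) ^ k \<in> Zp" for k by (intro Zp_power Zp_minus Zp_1)
    show ?thesis
      by (intro pcong_lmult pcong_mult' 1 2 3 fact_p_add pcong_refl s Zp_mult Zp_minus Zp_fact z Zp_inverse_fact_sq ji)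
  qed
  also have "\<dots> = - (\<alpha> m * \<rho> m r)"
  proof -
    have "(-1) ^ p = (-1 :: rat)" using p_odd by simp
    moreover have "(-1) ^ r * (-1) ^ r = (1 :: rat)" "(-1) ^ m * (-1) ^ m = (1 :: rat)"
      by (simp_all add: power_add[symmetric] mult_2[symmetric])
    ultimately have sg: "(-1) ^ (p + r) * (-1) ^ r * (-1) ^ (m + 1) * (-1) ^ (m + 1) = (-1 :: rat)"
      by (simp add: power_add)
    have "(-1) ^ (p + r) * ((- (1 / fact (2 * m + 1))) * ((- fact r)
      * (((-1) ^ (m + 1) * fact m) * (((-1) ^ (m + 1) * fact m) * (((-1) ^ r * fact (2 * m + 1 + r)) * (1 / (fact i)\<^sup>2))))))
      = ((-1) ^ (p + r) * (-1) ^ r * (-1) ^ (m + 1) * (-1) ^ (m + 1)) *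
        ((fact m)\<^sup>2 / fact (2 * m + 1) * (fact r * fact (2 * m + 1 + r) / (fact i)\<^sup>2) :: rat)"
      by (simp only: power2_eq_square divide_inverse mult_minus_left mult_minus_right minus_minus mult_1 mult_ac)
    then show ?thesis unfolding sg \<alpha>_def \<rho>_def i_def by (simp add: add_ac)
  qed
  finally show ?thesis unfolding j_def i_def .
qed

text \<open>Reorder by j and i = n - j. Each row j is completed to all i <= j, where it sums to
  C(2j,j); the surplus i >= p - j is the tail, reindexed by m = p - 1 - j.\<close>

lemma alternating_franel_sum:
  "(\<Sum>k<p. (-1) ^ k * of_nat (franel k))
     = (\<Sum>j<p. of_nat (2 * j choose j)) - (\<Sum>m<half. \<Sum>r<p - 1 - 2 * m. \<tau> (p - 1 - m) (m + 1 + r))"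
proof -
  have "(\<Sum>k<p. (-1) ^ k * of_nat (franel k)) = (\<Sum>k<p. \<Sum>j\<le>k. \<tau> j (k - j))"
    unfolding franel_eq_sum_choose of_nat_sum sum_distrib_left \<tau>_def
    by (intro sum.cong refl) (auto simp: mult_ac)
  also have "\<dots> = sum (\<lambda>(j, i). \<tau> j i) {(j, i). j + i < p}"
    by (rule sum.triangle_reindex[symmetric])
  also have "{(j, i). j + i < p} = Sigma {..<p} (\<lambda>j. {..<p - j})" by auto
  also have "sum (\<lambda>(j, i). \<tau> j i) (Sigma {..<p} (\<lambda>j. {..<p - j})) = (\<Sum>j<p. \<Sum>i<p - j. \<tau> j i)"
    by (rule sum.Sigma[symmetric]) auto
  also have "\<dots> = (\<Sum>j<p. of_nat (2 * j choose j) - (\<Sum>i\<in>{p - j..j}. \<tau> j i))"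
  proof (intro sum.cong refl)
    fix j assume j: "j \<in> {..<p}"
    have "of_nat (2 * j choose j) = of_nat (2 * j choose j) * (\<Sum>i\<le>j. (-1) ^ (j + i) * of_nat ((j + i) choose j) * of_nat (j choose i) :: rat)"
      by (simp only: central_convolution_sum mult_1_right)
    also have "\<dots> = (\<Sum>i\<le>j. \<tau> j i)"
      unfolding sum_distrib_left \<tau>_def by (intro sum.cong refl) (simp add: mult_ac)
    also have "\<dots> = (\<Sum>i\<in>{..<p - j} \<union> {p - j..j}. \<tau> j i)"
      by (rule sum.mono_neutral_left) (auto simp: \<tau>_def binomial_eq_0)
    also have "\<dots> = (\<Sum>i<p - j. \<tau> j i) + (\<Sum>i\<in>{p - j..j}. \<tau> j i)"
      by (rule sum.union_disjoint) auto
    finally show "(\<Sum>i<p - j. \<tau> j i) = of_nat (2 * j choose j) - (\<Sum>i\<in>{p - j..j}. \<tau> j i)" by simp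
  qed
  also have "\<dots> = (\<Sum>j<p. of_nat (2 * j choose j)) - (\<Sum>j<p. \<Sum>i\<in>{p - j..j}. \<tau> j i)"
    by (rule sum_subtractf)
  also have "(\<Sum>j<p. \<Sum>i\<in>{p - j..j}. \<tau> j i) = (\<Sum>m<p. \<Sum>i\<in>{p - (p - Suc m)..p - Suc m}. \<tau> (p - Suc m) i)"
    by (rule sum.nat_diff_reindex[symmetric])
  also have "\<dots> = (\<Sum>m<p. \<Sum>r<p - 1 - 2 * m. \<tau> (p - 1 - m) (m + 1 + r))"
  proof (rule sum.cong[OF refl])
    fix m assume m: "m \<in> {..<p}"
    show "(\<Sum>i\<in>{p - (p - Suc m)..p - Suc m}. \<tau> (p - Suc m) i) = (\<Sum>r<p - 1 - 2 * m. \<tau> (p - 1 - m) (m + 1 + r))"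
      by (rule sum.reindex_bij_witness[where i = "\<lambda>r. m + 1 + r" and j = "\<lambda>i. i - (m + 1)"]) (use m in auto)
  qed
  \<comment> \<open>For m >= \<open>half\<close> truncated subtraction makes the range of r
    empty.\<close>
  also have "\<dots> = (\<Sum>m<half. \<Sum>r<p - 1 - 2 * m. \<tau> (p - 1 - m) (m + 1 + r))"
    using two_half by (intro sum.mono_neutral_right) auto
  finally show ?thesis .
qed

section \<open>Evaluation of the inner tail sums by telescoping\<close>

definition b :: "nat \<Rightarrow> rat" where "b m = (\<Sum>k=1..m. of_nat (2 * k choose k) / of_nat k)"

lemma b_0 [simp]: "b 0 = 0" and b_Suc: "b (Suc m) = b m + of_nat (2 * Suc m choose Suc m) / of_nat (Suc m)"
  by (simp_all add: b_def del: of_nat_Suc)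

text \<open>With \<open>s = m + r + 1\<close> the summand \<open>\<rho> m r\<close> is \<open>(s+m)! (s-m-1)!/(s!)\<^sup>2\<close>. For fixed \<open>s\<close> its difference in
  \<open>m\<close> is Gosper-summable in \<open>s\<close>, which is what makes \<open>\<delta>\<close> computable.\<close>
lemma \<rho>_diff:
  "\<rho> (Suc l) r - \<rho> l (Suc r) = 2 / of_nat (Suc l) *
     (fact (2 * Suc l + r) * fact r / (fact (Suc l + r))\<^sup>2 - fact (2 * Suc l + Suc r) * fact (Suc r) / (fact (Suc l + Suc r))\<^sup>2)"
proof -
  define A B :: rat where "A = fact r * fact (2 * Suc l + r)" and "B = fact (Suc l + r)"
  define x y :: rat where "x = of_nat (Suc l)" and "y = of_nat (Suc r)"
  have B0: "B \<noteq> 0" and x0: "x \<noteq> 0" and xy: "x + y \<noteq> 0"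
    unfolding B_def x_def y_def by (simp_all del: of_nat_Suc add: of_nat_add[symmetric])
  have xy': "of_nat (Suc (Suc l + r)) = x + y" and x2y: "of_nat (Suc (2 * Suc l + r)) = 2 * x + y"
    unfolding x_def y_def by simp_all
  have f1: "(fact (Suc l + Suc r) :: rat) = (x + y) * B"
    unfolding add_Suc_right fact_Suc xy' B_def ..
  have f2: "(fact (2 * Suc l + Suc r) :: rat) = (2 * x + y) * fact (2 * Suc l + r)"
    unfolding add_Suc_right fact_Suc x2y ..
  have f3: "(fact (Suc r) :: rat) = y * fact r" unfolding y_def by simp
  have e: "2 * Suc l + 1 + r = 2 * Suc l + Suc r" "Suc l + r + 1 = Suc l + Suc r"
    "2 * l + 1 + Suc r = 2 * Suc l + r" "l + Suc r + 1 = Suc l + Suc r" by simp_all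
  have r1: "\<rho> (Suc l) r = A * (2 * x + y) / ((x + y) * B)\<^sup>2"
    unfolding \<rho>_def e f1 f2 A_def by simp
  have r2: "\<rho> l (Suc r) = A * y / ((x + y) * B)\<^sup>2"
    unfolding \<rho>_def e f1 f3 A_def by simp
  have g: "fact (2 * Suc l + r) * fact r / (fact (Suc l + r))\<^sup>2 = A / B\<^sup>2"
    "fact (2 * Suc l + Suc r) * fact (Suc r) / (fact (Suc l + Suc r))\<^sup>2 = A * (2 * x + y) * y / ((x + y) * B)\<^sup>2"
    unfolding f1 f2 f3 A_def B_def by simp_all
  have "A * (2 * x + y) / ((x + y) * B)\<^sup>2 - A * y / ((x + y) * B)\<^sup>2 = A * (2 * x) / ((x + y) * B)\<^sup>2"
    by (simp add: diff_divide_distrib[symmetric] algebra_simps)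
  moreover have "A / B\<^sup>2 = A * (x + y)\<^sup>2 / ((x + y) * B)\<^sup>2"
    using xy by (simp add: power_mult_distrib)
  moreover have "A * (x + y)\<^sup>2 / ((x + y) * B)\<^sup>2 - A * (2 * x + y) * y / ((x + y) * B)\<^sup>2 = A * x\<^sup>2 / ((x + y) * B)\<^sup>2"
    unfolding diff_divide_distrib[symmetric] by (simp add: power2_eq_square algebra_simps)
  moreover have "2 / x * (A * x\<^sup>2 / ((x + y) * B)\<^sup>2) = A * (2 * x) / ((x + y) * B)\<^sup>2"
    using x0 by (simp add: power2_eq_square)
  ultimately show ?thesis unfolding r1 r2 g x_def[symmetric] by simp
qed

text \<open>Compare \<open>\<delta> (Suc l)\<close> with \<open>\<delta> l\<close> stripped of its
  first and last terms: the difference telescopes by \<open>\<rho>_diff\<close>. The boundary values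
  at the upper end involve 1/C and cancel; 2C/m - C/(2m) = (3/2) C/m remains.\<close>

lemma \<delta>_step:
  assumes "Suc l \<le> half"
  shows "\<delta> (Suc l) \<approx> \<delta> l + 3 / 2 * (of_nat (2 * Suc l choose Suc l) / of_nat (Suc l))"
proof -
  define m where "m = Suc l"
  define L where "L = p - 1 - 2 * m"
  define C :: rat where "C = of_nat (2 * m choose m)"
  have m: "m \<ge> 1" "2 * m < p" "p = L + 2 * m + 1" using assms two_half by (auto simp: m_def L_def)
  define g :: "nat \<Rightarrow> rat" where "g r = fact (2 * m + r) * fact r / (fact (m + r))\<^sup>2" for r
  have C: "C = fact (2 * m) / (fact m)\<^sup>2"
    unfolding C_def by (subst binomial_fact) (auto simp: power2_eq_square)
  have m0: "of_nat m \<noteq> (0::rat)" using m by simp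
  have fm: "fact m = (of_nat m * fact l :: rat)" "fact (2 * m) = (2 * of_nat m * fact (2 * l + 1) :: rat)"
    unfolding m_def by (simp_all add: algebra_simps)
  have "p - 1 - 2 * l = Suc (Suc L)" using m by (simp add: m_def)
  then have "\<delta> l = \<rho> l 0 + (\<Sum>r<L. \<rho> l (Suc r)) + \<rho> l (Suc L)"
    unfolding \<delta>_def by (simp only: sum.lessThan_Suc[of _ "Suc L"] sum.lessThan_Suc_shift[of _ L])
  moreover have "\<delta> m - (\<Sum>r<L. \<rho> l (Suc r)) = 2 / of_nat m * (g 0 - g L)"
  proof -
    have "\<delta> m - (\<Sum>r<L. \<rho> l (Suc r)) = (\<Sum>r<L. \<rho> m r - \<rho> l (Suc r))"
      by (simp add: \<delta>_def L_def sum_subtractf)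
    also have "\<dots> = (\<Sum>r<L. 2 / of_nat m * (g r - g (Suc r)))"
      unfolding m_def \<rho>_diff g_def ..
    also have "\<dots> = 2 / of_nat m * (g 0 - g L)"
      by (simp only: sum_distrib_left[symmetric] sum_lessThan_telescope')
    finally show ?thesis .
  qed
  moreover have "g 0 = C" unfolding g_def C by simp
  moreover have "\<rho> l 0 = C / (2 * of_nat m)"
    unfolding \<rho>_def C fm(2) using m0 by (simp add: m_def power2_eq_square del: fact_Suc of_nat_Suc)
  ultimately have e: "\<delta> m = \<delta> l + 2 / of_nat m * (C - g L) - C / (2 * of_nat m) - \<rho> l (Suc L)"
    by simp
  have inv: "1 / fact (p - 1 - a) * (1 / fact (p - 1 - a)) \<approx> (fact a)\<^sup>2" if "a < p" for a
  proof -
    have s: "(-1) ^ (a + 1) * fact a \<in> Zp" by (intro Zp_mult Zp_power Zp_minus Zp_1 Zp_fact)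
    have "(-1) ^ (a + 1) * fact a * ((-1) ^ (a + 1) * fact a) = ((fact a)\<^sup>2 :: rat)"
      by (simp add: power2_eq_square mult_ac power_add[symmetric] mult_2[symmetric])
    then show ?thesis
      using pcong_mult'[OF inverse_fact_p_minus[OF that] inverse_fact_p_minus[OF that] s s] by simp
  qed
  \<comment> \<open>Here 2m + L = p - 1 and m + L = p - 1 - m, so the factorials at the upper end
    reflect to those in C(2m,m).\<close>
  have gL: "g L \<approx> 1 / C"
  proof -
    have "g L = fact (p - 1) * (fact (p - 1 - 2 * m) * (1 / fact (p - 1 - m) * (1 / fact (p - 1 - m))))"
      unfolding g_def using m by (simp add: power2_eq_square add_ac)
    also have "\<dots> \<approx> - 1 * ((-1) ^ (2 * m + 1) / fact (2 * m) * (fact m)\<^sup>2)"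
      using m by (intro pcong_mult' wilson fact_p_minus inv Zp_mult Zp_divide_fact Zp_power Zp_minus Zp_1 Zp_fact) auto
    also have "\<dots> = 1 / C" unfolding C by simp
    finally show ?thesis .
  qed
  have rL: "\<rho> l (Suc L) \<approx> - (2 / of_nat m * (1 / C))"
  proof -
    have "\<rho> l (Suc L) = fact (p - 1) * (fact (p - 1 - (2 * l + 1)) * (1 / fact (p - 1 - l) * (1 / fact (p - 1 - l))))"
      unfolding \<rho>_def using m by (simp add: m_def power2_eq_square add_ac mult_ac del: fact_Suc)
    also have "\<dots> \<approx> - 1 * ((-1) ^ (2 * l + 1 + 1) / fact (2 * l + 1) * (fact l)\<^sup>2)"
      using m by (intro pcong_mult' wilson fact_p_minus inv Zp_mult Zp_divide_fact Zp_power Zp_minus Zp_1 Zp_fact) (auto simp: m_def)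
    also have "\<dots> = - (2 / of_nat m * (1 / C))"
      unfolding C fm using m0 by (simp add: power2_eq_square del: fact_Suc of_nat_Suc)
    finally show ?thesis .
  qed
  have z: "2 / of_nat m \<in> Zp" using m(1,2) by (intro Zp_divide_lt Zp_numeral) auto
  have "\<delta> m \<approx> \<delta> l + 2 / of_nat m * (C - 1 / C) - C / (2 * of_nat m) - (- (2 / of_nat m * (1 / C)))"
    unfolding e by (intro pcong_add pcong_diff pcong_lmult pcong_refl z gL rL)
  also have "\<dots> = \<delta> l + 3 / 2 * (C / of_nat m)"
    using m0 by (simp add: field_simps)
  finally show ?thesis unfolding m_def C_def .
qed

lemma \<delta>_eq_b: "m \<le> half \<Longrightarrow> \<delta> m \<approx> 3 / 2 * b m"
proof (induction m)
  case 0
  have "\<delta> 0 = H (p - 1)"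
    unfolding \<delta>_def H_def
  proof (rule sum.reindex_bij_witness[where j = Suc and i = "\<lambda>k. k - 1"])
    fix r show "1 / of_nat (Suc r) = \<rho> 0 r" unfolding \<rho>_def by (simp add: power2_eq_square)
  qed auto
  then show ?case using H_p_minus_1 by simp
next
  case (Suc l)
  have "\<delta> (Suc l) \<approx> \<delta> l + 3 / 2 * (of_nat (2 * Suc l choose Suc l) / of_nat (Suc l))"
    using Suc by (intro \<delta>_step)
  also have "\<dots> \<approx> 3 / 2 * b l + 3 / 2 * (of_nat (2 * Suc l choose Suc l) / of_nat (Suc l))"
    using Suc by (intro pcong_add) auto
  also have "\<dots> = 3 / 2 * b (Suc l)" by (simp only: b_Suc distrib_left)
  finally show ?case .
qed

text \<open>The range of the sum \<open>\<delta> half\<close> is empty. The result removes the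
  boundary term in the telescoped product below.\<close>

lemma b_half: "b half \<approx> 0"
proof -
  have "\<delta> half = 0" unfolding \<delta>_def using two_half by simp
  then have "0 \<approx> 3 / 2 * b half" using \<delta>_eq_b[of half] by simp
  then have "2 / 3 * 0 \<approx> 2 / 3 * (3 / 2 * b half)" by (intro pcong_lmult) auto
  then show ?thesis using pcong_sym by simp
qed

section \<open>Generating polynomials in t - t^2\<close>

abbreviation X :: "rat poly" where "X \<equiv> [:0, 1, -1:]"

abbreviation c :: "nat \<Rightarrow> rat" where "c k \<equiv> of_nat (2 * k choose k) / of_nat k"

lemma Zp_coeff_X: "coeff (X ^ k) r \<in> Zp"
  unfolding coeff_quadratic_power by (auto intro!: Zp_mult Zp_power Zp_minus)

text \<open>Summation by parts: the quadratic is 1 - X, and the increments of \<open>b\<close> are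
  the \<open>c k\<close>.\<close>

lemma X_telescope:
  "[:1, -1, 1:] * (\<Sum>m<n. smult (b m) (X ^ m))
     = (\<Sum>k=1..n. smult (c k) (X ^ k)) - smult (b n) (X ^ n)"
proof (induction n)
  case (Suc n)
  have e: "[:1, -1, 1:] = 1 - X" by (simp add: one_pCons)
  have "[:1, -1, 1:] * smult (b n) (X ^ n) = smult (b n) (X ^ n) - smult (b n) (X ^ Suc n)"
    unfolding e by (simp only: left_diff_distrib mult_1 mult_smult_right power_Suc smult_diff_right)
  moreover have "smult (b (Suc n)) (X ^ Suc n) = smult (b n) (X ^ Suc n) + smult (c (Suc n)) (X ^ Suc n)"
    by (simp only: b_Suc smult_add_left)
  moreover have "(\<Sum>k=1..Suc n. smult (c k) (X ^ k)) = (\<Sum>k=1..n. smult (c k) (X ^ k)) + smult (c (Suc n)) (X ^ Suc n)"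
    by (subst sum.nat_ivl_Suc') (simp, rule add.commute)
  moreover have "(s - u) + (u - v) = s + w - (v + w)" for s u v w :: "rat poly" by simp
  ultimately show ?case by (simp only: sum.lessThan_Suc distrib_left Suc)
qed simp

lemma c_pcong_0:
  assumes "half < k" "k < p"
  shows "c k \<approx> 0"
proof -
  have "p \<le> 2 * k" using assms two_half by linarith
  then have "p dvd fact (2 * k)" using prime_dvd_fact_iff[OF prime_p] by blast
  moreover have "fact k * fact (2 * k - k) * (2 * k choose k) = (fact (2 * k) :: nat)"
    by (rule binomial_fact_lemma) simp
  moreover have "2 * k - k = k" by simp
  ultimately have "p dvd fact k * fact k * (2 * k choose k)" by (simp only:)
  then have "p dvd (2 * k choose k)"
    using not_p_dvd_fact[OF assms(2)] by (simp only: prime_dvd_mult_iff[OF prime_p]) blast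
  then obtain d where d: "2 * k choose k = p * d" by blast
  have e: "c k = of_nat p * (of_nat d / of_nat k)" by (simp only: d of_nat_mult times_divide_eq_right)
  have "of_nat d / of_nat k \<in> Zp" using assms by (intro Zp_divide_lt) auto
  then show ?thesis unfolding e by (rule pcong_p_mult)
qed

text \<open>Its integral over [0,1] is the sum of the \<open>\<alpha> m * b m\<close>.\<close>

definition M :: "rat poly" where "M = (\<Sum>m<half. smult (b m) (X ^ m))"

lemma coeff_telescope_0: "coeff ([:1, -1, 1:] * M) 0 = 0"
  using two_half p_gt_3 unfolding M_def X_telescope
  by (simp add: coeff_sum coeff_quadratic_power)

text \<open>Modulo p the boundary term drops out by \<open>b_half\<close>, and \<open>c k\<close>
  vanishes for half < k < p, so the sum may be extended to all k below p, where
  \<open>sum_choose_over_index\<close> evaluates it.\<close>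

lemma coeff_telescope:
  assumes "1 \<le> r" "r < p"
  shows "coeff ([:1, -1, 1:] * M) r \<approx> 2 / of_nat r"
proof -
  define A B where "A = (\<Sum>k=1..half. c k * coeff (X ^ k) r)" and "B = (\<Sum>k=Suc half..p-1. c k * coeff (X ^ k) r)"
  have "2 / of_nat r = (\<Sum>k=1..r. c k * coeff (X ^ k) r)"
    unfolding sum_choose_over_index[OF assms(1), symmetric]
    by (intro sum.cong refl) (auto simp: coeff_quadratic_power)
  also have "\<dots> = (\<Sum>k=1..p-1. c k * coeff (X ^ k) r)"
    using assms by (intro sum.mono_neutral_left) (auto simp: coeff_quadratic_power)
  also have "{1..p-1} = {1..half} \<union> {Suc half..p-1}" using two_half by auto
  also have "(\<Sum>k\<in>{1..half} \<union> {Suc half..p-1}. c k * coeff (X ^ k) r) = A + B"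
    unfolding A_def B_def by (rule sum.union_disjoint) auto
  finally have AB: "A + B = 2 / of_nat r" by (rule sym)
  have "B \<approx> (\<Sum>k=Suc half..p-1. 0 * coeff (X ^ k) r)"
    unfolding B_def
  proof (intro pcong_sum pcong_rmult Zp_coeff_X c_pcong_0)
    fix k assume "k \<in> {Suc half..p-1}"
    then show "half < k" "k < p" using p_gt_3 by auto
  qed
  then have B: "B \<approx> 0" by simp
  have "coeff ([:1, -1, 1:] * M) r = A + 0 - b half * coeff (X ^ half) r"
    unfolding M_def X_telescope A_def by (simp only: coeff_diff coeff_sum coeff_smult add_0_right)
  also have "\<dots> \<approx> A + B - 0 * coeff (X ^ half) r"
    by (intro pcong_add pcong_diff pcong_rmult pcong_refl Zp_coeff_X b_half pcong_sym[OF B])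
  also have "\<dots> = 2 / of_nat r" by (simp add: AB)
  finally show ?thesis .
qed

text \<open>Since \<open>\<alpha> m\<close> is the integral of X^m over [0,1], it is obtained by
  integrating termwise. The bound p - 1 exceeds the degree 2m and does not depend on m, which allows
  the sums to be interchanged later.\<close>

lemma \<alpha>_eq_coeff_sum:
  assumes "m < half"
  shows "\<alpha> m = (\<Sum>r<p - 1. coeff (X ^ m) r / of_nat (r + 1))"
proof -
  have coeff: "coeff (X ^ m) (m + i) = (-1) ^ i * of_nat (m choose i)" for i
  proof -
    have "(-1) ^ (m + i + m) = ((-1) ^ i :: rat)" by (simp add: minus_one_power_iff)
    then show ?thesis unfolding coeff_quadratic_power by simp
  qed
  have "(\<Sum>r<p - 1. coeff (X ^ m) r / of_nat (r + 1)) = (\<Sum>r\<in>{m..2 * m}. coeff (X ^ m) r / of_nat (r + 1))"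
  proof (rule sum.mono_neutral_right)
    show "{m..2 * m} \<subseteq> {..<p - 1}" using assms two_half by auto
    show "\<forall>r\<in>{..<p - 1} - {m..2 * m}. coeff (X ^ m) r / of_nat (r + 1) = 0"
    proof
      fix r assume "r \<in> {..<p - 1} - {m..2 * m}"
      then have "r < m \<or> m < r - m" by auto
      then show "coeff (X ^ m) r / of_nat (r + 1) = 0"
        unfolding coeff_quadratic_power by (auto simp: binomial_eq_0)
    qed
  qed simp
  also have "\<dots> = (\<Sum>i\<le>m. coeff (X ^ m) (m + i) / of_nat (m + i + 1))"
    by (rule sum.reindex_bij_witness[where i = "\<lambda>i. m + i" and j = "\<lambda>r. r - m"]) auto
  also have "\<dots> = (\<Sum>i\<le>m. (-1) ^ i * of_nat (m choose i) / of_nat (m + i + 1))"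
    by (simp only: coeff)
  also have "\<dots> = \<alpha> m"
    unfolding alternating_choose_beta_sum \<alpha>_def by (simp only: power2_eq_square mult_2)
  finally show ?thesis ..
qed

text \<open>Integrate \<open>M\<close> coefficientwise. Division by 1 - t + t^2 through
  \<open>coeff_via_hexa\<close> yields a double sum of 2 hexa(j - i)/(i j) over i < j, which partial
  fractions turn into harmonic sums.\<close>

lemma sum_\<alpha>_b: "(\<Sum>m<half. \<alpha> m * b m) \<approx> 8 * S"
proof -
  let ?h = "\<lambda>d. of_int (hexa d) :: rat"
  have "(\<Sum>m<half. \<alpha> m * b m) = (\<Sum>m<half. \<Sum>r<p - 1. b m * coeff (X ^ m) r / of_nat (r + 1))"
  proof (rule sum.cong[OF refl])
    fix m assume "m \<in> {..<half}"
    then have "m < half" by simp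
    then show "\<alpha> m * b m = (\<Sum>r<p - 1. b m * coeff (X ^ m) r / of_nat (r + 1))"
      unfolding \<alpha>_eq_coeff_sum[OF \<open>m < half\<close>] sum_distrib_right by (intro sum.cong refl) simp
  qed
  also have "\<dots> = (\<Sum>r<p - 1. coeff M r / of_nat (r + 1))"
    unfolding M_def coeff_sum coeff_smult sum_divide_distrib by (rule sum.swap)
  also have "\<dots> \<approx> (\<Sum>r<p - 1. (\<Sum>i=1..r. ?h (int r + 1 - int i) * (2 / of_nat i)) / of_nat (r + 1))"
  proof (rule pcong_sum)
    fix r assume r: "r \<in> {..<p - 1}"
    have "coeff M r = (\<Sum>i\<le>r. ?h (int r + 1 - int i) * coeff ([:1, -1, 1:] * M) i)"
      by (rule coeff_via_hexa)
    also have "\<dots> = (\<Sum>i=1..r. ?h (int r + 1 - int i) * coeff ([:1, -1, 1:] * M) i)"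
    proof (rule sum.mono_neutral_right)
      show "\<forall>i\<in>{..r} - {1..r}. ?h (int r + 1 - int i) * coeff ([:1, -1, 1:] * M) i = 0"
      proof
        fix i assume "i \<in> {..r} - {1..r}"
        then have "i = 0" by auto
        then show "?h (int r + 1 - int i) * coeff ([:1, -1, 1:] * M) i = 0"
          by (simp only: coeff_telescope_0 mult_zero_right)
      qed
    qed auto
    also have "\<dots> \<approx> (\<Sum>i=1..r. ?h (int r + 1 - int i) * (2 / of_nat i))"
      using r by (intro pcong_sum pcong_lmult Zp_of_int coeff_telescope) auto
    finally show "coeff M r / of_nat (r + 1) \<approx> (\<Sum>i=1..r. ?h (int r + 1 - int i) * (2 / of_nat i)) / of_nat (r + 1)"
      using r by (intro pcong_divide_lt) auto
  qed
  also have "(\<Sum>r<p - 1. (\<Sum>i=1..r. ?h (int r + 1 - int i) * (2 / of_nat i)) / of_nat (r + 1))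
      = (\<Sum>j=1..p-1. \<Sum>i\<in>{1..<j}. ?h (int j - int i) * (2 / of_nat i) / of_nat j)"
    unfolding sum_divide_distrib
    by (rule sum.reindex_bij_witness[where i = "\<lambda>j. j - 1" and j = "\<lambda>r. r + 1"])
       (auto simp: algebra_simps atLeastLessThanSuc_atLeastAtMost)
  also have "\<dots> = (\<Sum>(j, i)\<in>Sigma {1..p-1} (\<lambda>j. {1..<j}). ?h (int j - int i) * (2 / of_nat i) / of_nat j)"
    by (rule sum.Sigma) auto
  \<comment> \<open>With d = j - i the weight depends on d alone, so the inner sum over i becomes
    harmonic.\<close>
  also have "\<dots> = (\<Sum>(d, i)\<in>Sigma {1..p-1} (\<lambda>d. {1..p - 1 - d}). ?h (int d) * (2 / of_nat i) / of_nat (d + i))"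
    by (rule sum.reindex_bij_witness[where i = "\<lambda>(d, i). (d + i, i)" and j = "\<lambda>(j, i). (j - i, i)"])
       (auto simp: of_nat_diff)
  also have "\<dots> = (\<Sum>d=1..p-1. \<Sum>i=1..p - 1 - d. ?h (int d) * (2 / of_nat i) / of_nat (d + i))"
    by (rule sum.Sigma[symmetric]) auto
  also have "\<dots> = (\<Sum>d=1..p-1. 2 * ?h (int d) / of_nat d * (H (p - 1 - d) + H d - H (p - 1)))"
  proof (rule sum.cong[OF refl])
    fix d assume d: "d \<in> {1..p-1}"
    have "(\<Sum>i=1..p - 1 - d. ?h (int d) * (2 / of_nat i) / of_nat (d + i))
        = (\<Sum>i=1..p - 1 - d. 2 * ?h (int d) / of_nat d * (1 / of_nat i - 1 / of_nat (d + i)))"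
    proof (rule sum.cong[OF refl])
      fix i assume i: "i \<in> {1..p - 1 - d}"
      have nz: "of_nat i \<noteq> (0::rat)" "of_nat d \<noteq> (0::rat)" "of_nat d + of_nat i \<noteq> (0::rat)"
        using i d by (simp_all add: of_nat_add[symmetric] del: of_nat_add)
      then show "?h (int d) * (2 / of_nat i) / of_nat (d + i) = 2 * ?h (int d) / of_nat d * (1 / of_nat i - 1 / of_nat (d + i))"
        unfolding of_nat_add by (simp add: field_simps)
    qed
    also have "\<dots> = 2 * ?h (int d) / of_nat d * (H (p - 1 - d) - (\<Sum>i=1..p - 1 - d. 1 / of_nat (d + i)))"
      by (simp only: sum_distrib_left[symmetric] sum_subtractf H_def)
    also have "(\<Sum>i=1..p - 1 - d. 1 / of_nat (d + i)) = (\<Sum>k\<in>{d<..p - 1}. 1 / of_nat k :: rat)"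
      by (rule sum.reindex_bij_witness[where i = "\<lambda>k. k - d" and j = "\<lambda>i. d + i"]) auto
    also have "\<dots> = H (p - 1) - H d"
    proof -
      have "{1..p-1} = {1..d} \<union> {d<..p - 1}" using d by auto
      then have "H (p - 1) = H d + (\<Sum>k\<in>{d<..p - 1}. 1 / of_nat k)"
        unfolding H_def by (simp only:) (rule sum.union_disjoint; auto)
      then show ?thesis by simp
    qed
    finally show "(\<Sum>i=1..p - 1 - d. ?h (int d) * (2 / of_nat i) / of_nat (d + i))
        = 2 * ?h (int d) / of_nat d * (H (p - 1 - d) + H d - H (p - 1))"
      by (simp add: algebra_simps)
  qed
  also have "\<dots> \<approx> (\<Sum>d=1..p-1. 2 * ?h (int d) / of_nat d * (H d + H d - 0))"
    using p_gt_3
    by (intro pcong_sum pcong_lmult pcong_add pcong_diff pcong_refl H_reflect H_p_minus_1 Zp_divide_lt Zp_mult Zp_of_int) auto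
  \<comment> \<open>Splitting H d = H (d - 1) + 1/d brings one part into the form of
    \<open>sum_hexa_H_0\<close>; the other is \<open>S\<close> itself.\<close>
  also have "\<dots> = 4 * ((\<Sum>d=1..p-1. ?h (int d) * H (d - 1) / of_nat d) + S)"
  proof -
    have "2 * ?h (int d) / of_nat d * (H d + H d - 0)
        = 4 * (?h (int d) * H (d - 1) / of_nat d + ?h (int d) / (of_nat d)\<^sup>2)" if "d \<in> {1..p-1}" for d
    proof -
      have "H d = H (d - 1) + 1 / of_nat d" using \<open>d \<in> {1..p-1}\<close> H_Suc[of "d - 1"] by simp
      then show ?thesis by (simp add: power2_eq_square algebra_simps add_divide_distrib)
    qed
    then have "(\<Sum>d=1..p-1. 2 * ?h (int d) / of_nat d * (H d + H d - 0))
       = (\<Sum>d=1..p-1. 4 * (?h (int d) * H (d - 1) / of_nat d + ?h (int d) / (of_nat d)\<^sup>2))"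
      by (rule sum.cong[OF refl])
    then show ?thesis unfolding S_def by (simp only: sum_distrib_left[symmetric] sum.distrib)
  qed
  also have "\<dots> \<approx> 4 * (S + S)"
    by (intro pcong_lmult pcong_add sum_hexa_H_0 pcong_refl Zp_numeral)
  finally show ?thesis by simp
qed

lemma tail_pcong:
  "(\<Sum>m<half. \<Sum>r<p - 1 - 2 * m. \<tau> (p - 1 - m) (m + 1 + r)) / (of_nat p)\<^sup>2 \<approx> - 12 * S"
proof -
  have "(\<Sum>m<half. \<Sum>r<p - 1 - 2 * m. \<tau> (p - 1 - m) (m + 1 + r)) / (of_nat p)\<^sup>2
      = (\<Sum>m<half. \<Sum>r<p - 1 - 2 * m. \<tau> (p - 1 - m) (m + 1 + r) / (of_nat p)\<^sup>2)"
    by (simp only: sum_divide_distrib)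
  also have "\<dots> \<approx> (\<Sum>m<half. \<Sum>r<p - 1 - 2 * m. - (\<alpha> m * \<rho> m r))"
    by (intro pcong_sum tail_term) simp
  also have "\<dots> = - (\<Sum>m<half. \<alpha> m * \<delta> m)"
    by (simp add: \<delta>_def sum_negf sum_distrib_left)
  also have "\<dots> \<approx> - (\<Sum>m<half. \<alpha> m * (3 / 2 * b m))"
    by (intro pcong_minus pcong_sum pcong_lmult Zp_\<alpha> \<delta>_eq_b) auto
  also have "\<dots> = - (3 / 2 * (\<Sum>m<half. \<alpha> m * b m))"
    by (simp add: sum_distrib_left mult_ac)
  also have "\<dots> \<approx> - (3 / 2 * (8 * S))"
    by (intro pcong_minus pcong_lmult sum_\<alpha>_b) simp
  finally show ?thesis by simp
qed

section \<open>The Legendre symbol and the final combination\<close>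

lemma hexa_p: "hexa (int p) = Legendre (int p) 3"
proof -
  have "p mod 6 = 1 \<or> p mod 6 = 5" using p_odd not_3_dvd_p by presburger
  then show ?thesis
  proof
    assume p: "p mod 6 = 1"
    then have m: "int p mod 6 = 1" "int p mod 3 = 1" by presburger+
    then have "[1\<^sup>2 = int p] (mod 3)" by (simp add: cong_def)
    then have "QuadRes 3 (int p)" unfolding QuadRes_def by blast
    then show ?thesis using m by (simp add: hexa_def Legendre_def cong_def)
  next
    assume p: "p mod 6 = 5"
    then have m: "int p mod 6 = 5" "int p mod 3 = 2" by presburger+
    have "y\<^sup>2 mod 3 \<noteq> 2" for y :: int
    proof -
      have "y mod 3 = 0 \<or> y mod 3 = 1 \<or> y mod 3 = 2" by presburger
      moreover have "y\<^sup>2 mod 3 = (y mod 3)\<^sup>2 mod 3" by (simp add: power_mod)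
      ultimately show ?thesis by auto
    qed
    then have "\<not> QuadRes 3 (int p)" unfolding QuadRes_def cong_def using m by auto
    then show ?thesis using m by (simp add: hexa_def Legendre_def cong_def)
  qed
qed

text \<open>The central sum contributes -4 S, the subtracted tail +12 S, and the Bernoulli term
  -(2/3) 12 S = -8 S, which cancel. Dividing by p^2 and then working modulo p gives the congruence
  modulo p^3.\<close>

lemma alternating_franel_pcong:
  "((\<Sum>k<p. (-1) ^ k * of_nat (franel k))
     - (of_int (Legendre (int p) 3) + 2 * of_nat p ^ 2 / 3 * bernoulli_poly (p - 2) (1 / 3))) / (of_nat p)\<^sup>2 \<approx> 0"
proof -
  let ?C = "\<Sum>j<p. of_nat (2 * j choose j) :: rat"
  let ?T = "\<Sum>m<half. \<Sum>r<p - 1 - 2 * m. \<tau> (p - 1 - m) (m + 1 + r)"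
  let ?b = "bernoulli_poly (p - 2) (1 / 3)"
  have "((\<Sum>k<p. (-1) ^ k * of_nat (franel k))
     - (of_int (Legendre (int p) 3) + 2 * of_nat p ^ 2 / 3 * ?b)) / (of_nat p)\<^sup>2
     = (?C - of_int (hexa (int p))) / (of_nat p)\<^sup>2 - ?T / (of_nat p)\<^sup>2 - 2 / 3 * ?b"
    unfolding alternating_franel_sum hexa_p by (simp add: field_simps)
  also have "\<dots> \<approx> - 4 * S - (- 12 * S) - 2 / 3 * (12 * S)"
    by (intro pcong_diff pcong_lmult sum_central_choose_pcong tail_pcong bernoulli_third_S Zp_3 Zp_numeral)
  finally show ?thesis by simp
qed

end

theorem theorem1p2:
  fixes p :: nat
  assumes "prime p" and "p > 3"
  shows "rat_cong (\<Sum>k<p. (-1) ^ k * of_nat (franel k))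
                  (of_int (Legendre (int p) 3)
                     + 2 * of_nat p ^ 2 / 3 * bernoulli_poly (p - 2) (1 / 3))
                  (int p ^ 3) (int p)"
proof -
  interpret prime_gt_3 p by standard (fact assms)+
  show ?thesis
    using alternating_franel_pcong
    unfolding pcong_def Zp_def rat_cong_def
    by (simp add: power2_eq_square power3_eq_cube)
qed

end
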